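(* Let $q\colon G\to H$ be a quasi-isometry of finitely generated groups, let $\mathcal{P}$ and $\mathcal{Q}$ be finite collections of subgroups of $G$ and $H$ respectively, and let $S$ and $T$ be (not necessarily finite) generating sets of $G$ and $H$ respectively. Suppose that (i) $q\colon (G,\mathcal{P})\to (H,\mathcal{Q})$ is a quasi-isometry of pairs, and (ii) $q\colon \Gamma(G,S)\to\Gamma(H,T)$ is a quasi-isometry. Then the following statements hold: (1) If $\mathcal{P}$ and $\mathcal{Q}$ are reduced collections in $G$ and $H$ respectively, then $\mathcal{P}\hookrightarrow_h (G,S)$ if and only if $\mathcal{Q}\hookrightarrow_h (H,T)$. (2) If $\mathcal{Q}$ contains only infinite subgroups and $\mathcal{Q}\hookrightarrow_h (H,T)$, then $\mathcal{P}^*\hookrightarrow_h (G,S)$, where $\mathcal{P}^*$ is a refinement of $\mathcal{P}$ in $G$.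
   Context: Finitely generated groups carry word metrics from chosen finite generating sets. For a generating set $S$ of $G$, $\Gamma(G,S)$ is the Cayley graph, with vertex set $G$ and edges $\{g,gs\}$ ($g\in G$, $s\in S$); a map $q\colon G\to H$ is called a quasi-isometry $\Gamma(G,S)\to\Gamma(H,T)$ if it is a quasi-isometry for the word metrics $\mathrm{dist}_{(G,S)}$, $\mathrm{dist}_{(H,T)}$ (path metrics on vertices). For a collection $\mathcal{P}$ of subgroups of $G$, $G/\mathcal{P}$ denotes the set of all left cosets $gP$ with $g\in G$, $P\in\mathcal{P}$. Quasi-isometry of pairs: an $(L,C)$-quasi-isometry $q\colon G\to H$ of finitely generated groups is an $(L,C,M)$-quasi-isometry of pairs $q\colon(G,\mathcal{P})\to(H,\mathcal{Q})$ if the relation $\dot q=\{(A,B)\in G/\mathcal{P}\times H/\mathcal{Q} : \mathrm{hdist}_H(q(A),B)<M\}$ has surjective projections to $G/\mathcal{P}$ and to $H/\mathcal{Q}$, where $\mathrm{hdist}_H$ is Hausdorff distance in $H$ for the finite-generating-set word metric. It is a quasi-isometry of pairs if this holds for some $L,C,M$. Two subgroups are commensurable if their intersection has finite index in both. A collection $\mathcal{P}$ of subgroups of $G$ is reduced if for all $P,Q\in\mathcal{P}$ and $g\in G$, if $P$ and $gQg^{-1}$ are commensurable then $P=Q$ and $g\in P$. The commensurator of $P\le G$ is $\mathrm{Comm}_G(P)=\{g\in G : P\cap gPg^{-1}$ has finite index in both $P$ and $gPg^{-1}\}$. A refinement $\mathcal{P}^*$ of $\mathcal{P}$ in $G$ is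 a set of representatives of the conjugacy classes of the collection of subgroups $\{\mathrm{Comm}_G(gPg^{-1}) : P\in\mathcal{P},\ g\in G\}$. Hyperbolically embedded: for $S\subset G$, the coned-off Cayley graph $\hat\Gamma(G,\mathcal{P},S)$ has vertex set $G\cup G/\mathcal{P}$ and edges $\{g,gs\}$ for $g\in G$, $s\in S$, and $\{x,gP\}$ for $g\in G$, $P\in\mathcal{P}$, $x\in gP$. Vertices $gP$ are cone vertices. A graph $\Gamma$ is fine at a vertex $v$ if the set $T_v\Gamma$ of vertices adjacent to $v$, with the metric $\angle_v(x,y)$ = length of a shortest path from $x$ to $y$ in $\Gamma\setminus\{v\}$ ($\infty$ if none), is locally finite (balls of finite radius are finite). $\mathcal{P}\hookrightarrow_h(G,S)$ means that $\hat\Gamma(G,\mathcal{P},S)$ is a connected (Gromov) hyperbolic graph that is fine at every cone vertex. *)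

theory Defs
  imports
    "HOL-Library.Extended_Real"
    "HOL-Algebra.Generated_Groups"
    "HOL-Algebra.Left_Coset"
begin

section \<open>Graphs\<close>

text \<open>
  A graph is given by a vertex set \<open>V\<close> and a symmetric adjacency relation \<open>E \<subseteq> V \<times> V\<close>.
  Graphs may be infinite and of infinite valence. A loop is allowed; it changes no distance.
\<close>

text \<open>
  Length of a shortest path, \<open>\<infinity>\<close> if there is none: \<open>(x, y) \<in> E ^^ n\<close> says that there is a walk
  of length \<open>n\<close> from \<open>x\<close> to \<open>y\<close>, and the infimum of the empty set is \<open>\<infinity>\<close>.
\<close>

definition graph_dist :: "('v \<times> 'v) set \<Rightarrow> 'v \<Rightarrow> 'v \<Rightarrow> enat" where
  "graph_dist E x y = (INF n\<in>{n. (x, y) \<in> E ^^ n}. enat n)"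

definition graph_connected :: "'v set \<Rightarrow> ('v \<times> 'v) set \<Rightarrow> bool" where
  "graph_connected V E \<longleftrightarrow> (\<forall>x\<in>V. \<forall>y\<in>V. (x, y) \<in> E\<^sup>*)"

text \<open>A geodesic is given by the list of the vertices it passes through.\<close>

definition is_geodesic :: "'v set \<Rightarrow> ('v \<times> 'v) set \<Rightarrow> 'v \<Rightarrow> 'v \<Rightarrow> 'v list \<Rightarrow> bool" where
  "is_geodesic V E x y p \<longleftrightarrow>
     p \<noteq> [] \<and> set p \<subseteq> V \<and> hd p = x \<and> last p = y \<and>
     (\<forall>j<length p. \<forall>i\<le>j. graph_dist E (p ! i) (p ! j) = enat (j - i))"

text \<open>
  Gromov hyperbolicity of a connected graph: for some \<open>\<delta>\<close>, all geodesic triangles are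
  \<open>\<delta>\<close>-slim. It is enough to ask this for one side, since \<open>x\<close>, \<open>y\<close>, \<open>z\<close> may be permuted
  cyclically. Corners and points are taken among the vertices; compared with the geometric
  realization, this affects only the value of \<open>\<delta>\<close>.
\<close>

definition graph_hyperbolic :: "'v set \<Rightarrow> ('v \<times> 'v) set \<Rightarrow> bool" where
  "graph_hyperbolic V E \<longleftrightarrow>
     (\<exists>\<delta>::nat. \<forall>x\<in>V. \<forall>y\<in>V. \<forall>z\<in>V. \<forall>p q r.
        is_geodesic V E x y p \<longrightarrow> is_geodesic V E y z q \<longrightarrow> is_geodesic V E z x r \<longrightarrow>
        (\<forall>u\<in>set p. \<exists>w\<in>set q \<union> set r. graph_dist E u w \<le> enat \<delta>))"

definition graph_link :: "('v \<times> 'v) set \<Rightarrow> 'v \<Rightarrow> 'v set" where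
  "graph_link E v = {x. (v, x) \<in> E}"

definition angle_dist :: "('v \<times> 'v) set \<Rightarrow> 'v \<Rightarrow> 'v \<Rightarrow> 'v \<Rightarrow> enat" where
  "angle_dist E v x y = graph_dist {(a, b) \<in> E. a \<noteq> v \<and> b \<noteq> v} x y"

definition fine_at :: "('v \<times> 'v) set \<Rightarrow> 'v \<Rightarrow> bool" where
  "fine_at E v \<longleftrightarrow>
     (\<forall>x\<in>graph_link E v. \<forall>r::nat. finite {y \<in> graph_link E v. angle_dist E v x y \<le> enat r})"

section \<open>Quasi-isometries\<close>

text \<open>
  Distances take values in \<^typ>\<open>enat\<close>; they are compared with real constants in \<^typ>\<open>ereal\<close>.
\<close>

definition quasi_isometry_const ::
  "real \<Rightarrow> real \<Rightarrow> 'a set \<Rightarrow> ('a \<Rightarrow> 'a \<Rightarrow> enat) \<Rightarrow> 'b set \<Rightarrow> ('b \<Rightarrow> 'b \<Rightarrow> enat) \<Rightarrow> ('a \<Rightarrow> 'b) \<Rightarrow> bool"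
where
  "quasi_isometry_const L C X d Y d' q \<longleftrightarrow>
     L \<ge> 1 \<and> C \<ge> 0 \<and> q \<in> X \<rightarrow> Y \<and>
     (\<forall>x\<in>X. \<forall>x'\<in>X.
        ereal (1 / L) * ereal_of_enat (d x x') - ereal C \<le> ereal_of_enat (d' (q x) (q x')) \<and>
        ereal_of_enat (d' (q x) (q x')) \<le> ereal L * ereal_of_enat (d x x') + ereal C) \<and>
     (\<forall>y\<in>Y. \<exists>x\<in>X. ereal_of_enat (d' (q x) y) \<le> ereal C)"

definition quasi_isometry ::
  "'a set \<Rightarrow> ('a \<Rightarrow> 'a \<Rightarrow> enat) \<Rightarrow> 'b set \<Rightarrow> ('b \<Rightarrow> 'b \<Rightarrow> enat) \<Rightarrow> ('a \<Rightarrow> 'b) \<Rightarrow> bool"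
where
  "quasi_isometry X d Y d' q \<longleftrightarrow> (\<exists>L C. quasi_isometry_const L C X d Y d' q)"

definition hausdorff_dist :: "('a \<Rightarrow> 'a \<Rightarrow> enat) \<Rightarrow> 'a set \<Rightarrow> 'a set \<Rightarrow> enat" where
  "hausdorff_dist d A B = max (SUP a\<in>A. INF b\<in>B. d a b) (SUP b\<in>B. INF a\<in>A. d a b)"

section \<open>Cayley graphs and coned-off Cayley graphs\<close>

definition generating_set :: "('a, 'm) monoid_scheme \<Rightarrow> 'a set \<Rightarrow> bool" where
  "generating_set G S \<longleftrightarrow> S \<subseteq> carrier G \<and> generate G S = carrier G"

definition cayley_edges :: "('a, 'm) monoid_scheme \<Rightarrow> 'a set \<Rightarrow> ('a \<times> 'a) set" where
  "cayley_edges G S =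
     {(g, g \<otimes>\<^bsub>G\<^esub> s) |g s. g \<in> carrier G \<and> s \<in> S} \<union> {(g \<otimes>\<^bsub>G\<^esub> s, g) |g s. g \<in> carrier G \<and> s \<in> S}"

definition word_dist :: "('a, 'm) monoid_scheme \<Rightarrow> 'a set \<Rightarrow> 'a \<Rightarrow> 'a \<Rightarrow> enat" where
  "word_dist G S = graph_dist (cayley_edges G S)"

definition left_cosets :: "('a, 'm) monoid_scheme \<Rightarrow> 'a set set \<Rightarrow> 'a set set" where
  "left_cosets G \<P> = (\<Union>P\<in>\<P>. lcosets\<^bsub>G\<^esub> P)"

text \<open>In the coned-off Cayley graph, \<open>Inl g\<close> is a group element and \<open>Inr A\<close> a cone vertex.\<close>

definition coned_off_verts :: "('a, 'm) monoid_scheme \<Rightarrow> 'a set set \<Rightarrow> ('a + 'a set) set" where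
  "coned_off_verts G \<P> = carrier G <+> left_cosets G \<P>"

definition coned_off_edges ::
  "('a, 'm) monoid_scheme \<Rightarrow> 'a set set \<Rightarrow> 'a set \<Rightarrow> (('a + 'a set) \<times> ('a + 'a set)) set"
where
  "coned_off_edges G \<P> S =
     {(Inl x, Inl y) |x y. (x, y) \<in> cayley_edges G S} \<union>
     {(Inl x, Inr A) |x A. A \<in> left_cosets G \<P> \<and> x \<in> A} \<union>
     {(Inr A, Inl x) |x A. A \<in> left_cosets G \<P> \<and> x \<in> A}"

definition hyperbolically_embedded ::
  "('a, 'm) monoid_scheme \<Rightarrow> 'a set set \<Rightarrow> 'a set \<Rightarrow> bool"
where
  "hyperbolically_embedded G \<P> S \<longleftrightarrow>
     graph_connected (coned_off_verts G \<P>) (coned_off_edges G \<P> S) \<and>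
     graph_hyperbolic (coned_off_verts G \<P>) (coned_off_edges G \<P> S) \<and>
     (\<forall>A\<in>left_cosets G \<P>. fine_at (coned_off_edges G \<P> S) (Inr A))"

section \<open>Quasi-isometries of pairs\<close>

text \<open>\<open>S\<close> and \<open>T\<close> are the finite generating sets that define the word metrics of \<open>G\<close> and \<open>H\<close>.\<close>

definition qi_of_pairs_const ::
  "real \<Rightarrow> real \<Rightarrow> real \<Rightarrow> ('a, 'm) monoid_scheme \<Rightarrow> 'a set \<Rightarrow> 'a set set \<Rightarrow>
   ('b, 'n) monoid_scheme \<Rightarrow> 'b set \<Rightarrow> 'b set set \<Rightarrow> ('a \<Rightarrow> 'b) \<Rightarrow> bool"
where
  "qi_of_pairs_const L C M G S \<P> H T \<Q> q \<longleftrightarrow>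
     quasi_isometry_const L C (carrier G) (word_dist G S) (carrier H) (word_dist H T) q \<and>
     (let R = {(A, B) \<in> left_cosets G \<P> \<times> left_cosets H \<Q>.
                 ereal_of_enat (hausdorff_dist (word_dist H T) (q ` A) B) < ereal M}
      in fst ` R = left_cosets G \<P> \<and> snd ` R = left_cosets H \<Q>)"

definition qi_of_pairs ::
  "('a, 'm) monoid_scheme \<Rightarrow> 'a set \<Rightarrow> 'a set set \<Rightarrow>
   ('b, 'n) monoid_scheme \<Rightarrow> 'b set \<Rightarrow> 'b set set \<Rightarrow> ('a \<Rightarrow> 'b) \<Rightarrow> bool"
where
  "qi_of_pairs G S \<P> H T \<Q> q \<longleftrightarrow> (\<exists>L C M. qi_of_pairs_const L C M G S \<P> H T \<Q> q)"

section \<open>Commensurability, reduced collections and refinements\<close>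

definition conjugate :: "('a, 'm) monoid_scheme \<Rightarrow> 'a \<Rightarrow> 'a set \<Rightarrow> 'a set" where
  "conjugate G g P = (g <#\<^bsub>G\<^esub> P) #>\<^bsub>G\<^esub> (inv\<^bsub>G\<^esub> g)"

definition finite_index_in :: "('a, 'm) monoid_scheme \<Rightarrow> 'a set \<Rightarrow> 'a set \<Rightarrow> bool" where
  "finite_index_in G K P \<longleftrightarrow> finite (rcosets\<^bsub>G\<lparr>carrier := P\<rparr>\<^esub> K)"

definition commensurable :: "('a, 'm) monoid_scheme \<Rightarrow> 'a set \<Rightarrow> 'a set \<Rightarrow> bool" where
  "commensurable G P Q \<longleftrightarrow> finite_index_in G (P \<inter> Q) P \<and> finite_index_in G (P \<inter> Q) Q"

definition reduced :: "('a, 'm) monoid_scheme \<Rightarrow> 'a set set \<Rightarrow> bool" where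
  "reduced G \<P> \<longleftrightarrow>
     (\<forall>P\<in>\<P>. \<forall>Q\<in>\<P>. \<forall>g\<in>carrier G.
        commensurable G P (conjugate G g Q) \<longrightarrow> P = Q \<and> g \<in> P)"

definition commensurator :: "('a, 'm) monoid_scheme \<Rightarrow> 'a set \<Rightarrow> 'a set" where
  "commensurator G P = {g \<in> carrier G. commensurable G P (conjugate G g P)}"

definition is_refinement :: "('a, 'm) monoid_scheme \<Rightarrow> 'a set set \<Rightarrow> 'a set set \<Rightarrow> bool" where
  "is_refinement G \<P> \<R> \<longleftrightarrow>
     (let \<C> = {commensurator G (conjugate G g P) |g P. g \<in> carrier G \<and> P \<in> \<P>}
      in \<R> \<subseteq> \<C> \<and> (\<forall>K\<in>\<C>. \<exists>!R. R \<in> \<R> \<and> (\<exists>g\<in>carrier G. K = conjugate G g R)))"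

end

theory Submission
  imports Defs "HOL-Algebra.Group_Action"
begin

text \<open>
  Say that cosets \<open>A \<in> G/\<P>\<close> and \<open>B \<in> H/\<Q>\<close> correspond if \<open>q(A)\<close> and \<open>B\<close> are at bounded Hausdorff distance
  for the word metric of the finite generating set. Choosing a corresponding coset \<open>F(A)\<close> for each \<open>A\<close>
  extends \<open>q\<close> to a map of coned-off Cayley graphs. This map is Lipschitz: edges of \<open>\<Gamma>(G,S)\<close> go to
  bounded paths because \<open>q\<close> is a quasi-isometry for \<open>S\<close> and \<open>T\<close>, and edges to cone vertices because
  points close for the finite generating set are close for \<open>T\<close>. A quasi-inverse \<open>r\<close> of \<open>q\<close> gives
  a Lipschitz map back, so the coned-off graphs are quasi-isometric, and hyperbolicity passes from one
  to the other by the Morse lemma (\<open>slim_triangles_quasi_isometric_embedding\<close>,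
  \<open>slim_triangles_transfer\<close>).

  Fineness is more delicate. A path that misses the cone vertex of \<open>A\<close> has an image that misses the cone
  vertex of \<open>F(A)\<close> only if no other coset is mapped to \<open>F(A)\<close>. This holds if the cosets of \<open>\<P>\<close>
  are separated, which means that distinct ones are at infinite Hausdorff distance. Then small angles at
  \<open>A\<close> come from small angles at \<open>F(A)\<close>, and local finiteness is inherited because \<open>q\<close> is finite-to-one
  on balls (\<open>fine_at_transfer\<close>). So, if the cosets of \<open>\<P>\<close> are separated, \<open>\<Q> \<hookrightarrow>\<^sub>h (H,T)\<close> implies
  \<open>\<P> \<hookrightarrow>\<^sub>h (G,S)\<close> (\<open>hyperbolically_embedded_transfer\<close>).

  It remains to find separated cosets. Subgroups are commensurable exactly if they are at finite Hausdorff
  distance, so reduced collections have separated cosets; applying the transfer to \<open>q\<close> and to \<open>r\<close> gives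
  the first statement. For the second, fineness at the cone vertices of infinite cosets forces the cosets
  of \<open>\<Q>\<close> to be separated (\<open>separated_cosets_if_fine\<close>). Hence all translates of \<open>P\<close> by its commensurator
  correspond to a single coset of \<open>\<Q>\<close>, and so the commensurator lies in a bounded neighbourhood of \<open>P\<close>
  (\<open>commensurator_coarsely_equal\<close>). Replacing \<open>\<P>\<close> by its refinement therefore keeps the correspondence
  of cosets, and it makes the cosets separated (\<open>refinement_equivalence\<close>), so that the transfer applies.
\<close>

section \<open>Discrete geodesic spaces and hyperbolicity\<close>

text \<open>
  Distances are natural numbers and a segment is the set of vertices of a geodesic. Forgetting the
  direction of travel makes segments symmetric, so that a triangle may be read in any order.
\<close>

definition geodesic_segment ::
  "'v set \<Rightarrow> ('v \<Rightarrow> 'v \<Rightarrow> nat) \<Rightarrow> 'v \<Rightarrow> 'v \<Rightarrow> 'v set \<Rightarrow> bool" where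
  "geodesic_segment V d x y A \<longleftrightarrow>
     (\<exists>p n. (\<forall>i\<le>n. p i \<in> V) \<and> (\<forall>j\<le>n. \<forall>i\<le>j. d (p i) (p j) = j - i) \<and>
            p 0 = x \<and> p n = y \<and> A = p ` {..n})"

definition slim_triangles :: "'v set \<Rightarrow> ('v \<Rightarrow> 'v \<Rightarrow> nat) \<Rightarrow> nat \<Rightarrow> bool" where
  "slim_triangles V d \<delta> \<longleftrightarrow>
     (\<forall>x y z A B C. geodesic_segment V d x y A \<longrightarrow> geodesic_segment V d y z B \<longrightarrow>
        geodesic_segment V d z x C \<longrightarrow> (\<forall>u\<in>A. \<exists>w\<in>B \<union> C. d u w \<le> \<delta>))"

locale geodesic_space =
  fixes V :: "'v set" and d :: "'v \<Rightarrow> 'v \<Rightarrow> nat"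
  assumes dist_self: "x \<in> V \<Longrightarrow> d x x = 0"
    and dist_sym: "x \<in> V \<Longrightarrow> y \<in> V \<Longrightarrow> d x y = d y x"
    and dist_tri: "x \<in> V \<Longrightarrow> y \<in> V \<Longrightarrow> z \<in> V \<Longrightarrow> d x z \<le> d x y + d y z"
    and segment_exists: "x \<in> V \<Longrightarrow> y \<in> V \<Longrightarrow> \<exists>A. geodesic_segment V d x y A"
begin

lemma segment_sym:
  assumes "geodesic_segment V d x y A"
  shows "geodesic_segment V d y x A"
proof -
  obtain p n where p: "\<And>i. i \<le> n \<Longrightarrow> p i \<in> V"
      "\<And>i j. i \<le> j \<Longrightarrow> j \<le> n \<Longrightarrow> d (p i) (p j) = j - i"
    and ends: "p 0 = x" "p n = y" "A = p ` {..n}"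
    using assms unfolding geodesic_segment_def by blast
  let ?r = "\<lambda>i. p (n - i)"
  have "d (?r i) (?r j) = j - i" if "i \<le> j" "j \<le> n" for i j
  proof -
    have "d (?r i) (?r j) = d (?r j) (?r i)" by (rule dist_sym) (simp_all add: p(1))
    also have "\<dots> = (n - i) - (n - j)" using that by (intro p(2)) auto
    finally show ?thesis using that by simp
  qed
  moreover have "A = ?r ` {..n}"
  proof -
    have "?r ` {..n} = p ` ((\<lambda>i. n - i) ` {..n})" by (simp add: image_image)
    also have "(\<lambda>i. n - i) ` {..n} = {..n}"
      by (auto simp: image_iff) (metis atMost_iff diff_diff_cancel diff_le_self)
    finally show ?thesis using ends by simp
  qed
  ultimately show ?thesis
    unfolding geodesic_segment_def using p(1) ends
    by (intro exI[of _ ?r] exI[of _ n]) auto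
qed

lemma segmentD:
  assumes "geodesic_segment V d x y A"
  shows "x \<in> V" "y \<in> V" "A \<subseteq> V" "x \<in> A" "y \<in> A" "u \<in> A \<Longrightarrow> d x u \<le> d x y" "u \<in> A \<Longrightarrow> d u y \<le> d x y"
  using assms unfolding geodesic_segment_def by (auto 4 4)

lemma subsegment:
  assumes "\<And>i. i \<le> n \<Longrightarrow> p i \<in> V" "\<And>i j. i \<le> j \<Longrightarrow> j \<le> n \<Longrightarrow> d (p i) (p j) = j - i"
    and "a \<le> b" "b \<le> n"
  shows "geodesic_segment V d (p a) (p b) (p ` {a..b})"
  unfolding geodesic_segment_def
proof (intro exI[of _ "\<lambda>i. p (a + i)"] exI[of _ "b - a"] conjI allI impI)
  show "p ` {a..b} = (\<lambda>i. p (a + i)) ` {..b - a}"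
  proof -
    have "{a..b} = (\<lambda>i. a + i) ` {..b - a}"
      using assms(3) by (auto simp: image_iff) (metis atMost_iff diff_le_mono le_add_diff_inverse)
    then show ?thesis by (simp add: image_image)
  qed
qed (use assms in auto)

text \<open>
  Bisecting the chain gives the logarithm: a segment between its ends is \<open>\<delta>\<close>-close to the two
  segments that meet at the middle of the chain, and each of these spans a chain of half the length.
\<close>

lemma chain_near_segment:
  assumes slim: "slim_triangles V d \<delta>"
  shows "\<lbrakk> a \<le> b; b - a \<le> 2 ^ k; \<And>i. a \<le> i \<Longrightarrow> i \<le> b \<Longrightarrow> c i \<in> V;
           \<And>i. a \<le> i \<Longrightarrow> i < b \<Longrightarrow> d (c i) (c (Suc i)) \<le> s;
           geodesic_segment V d (c a) (c b) A; u \<in> A \<rbrakk>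
         \<Longrightarrow> \<exists>i. a \<le> i \<and> i \<le> b \<and> d u (c i) \<le> \<delta> * k + s"
proof (induction k arbitrary: a b A u)
  case 0
  have ca: "c a \<in> V" "u \<in> V" using segmentD[OF "0.prems"(5)] "0.prems"(6) by auto
  have "d (c a) (c b) \<le> s"
  proof (cases "b = a")
    case True
    then show ?thesis using ca dist_self by simp
  next
    case False
    then have "b = Suc a" using 0 by simp
    then show ?thesis using "0.prems"(4)[of a] by simp
  qed
  then have "d u (c a) \<le> s"
    using segmentD(6)[OF "0.prems"(5,6)] dist_sym[OF ca] by simp
  then show ?case using "0.prems"(1) by auto
next
  case (Suc k)
  define m where "m = (a + b) div 2"
  have m: "a \<le> m" "m \<le> b" "m - a \<le> 2 ^ k" "b - m \<le> 2 ^ k"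
    using Suc.prems(1,2) unfolding m_def by auto
  have cV: "c a \<in> V" "c b \<in> V" "c m \<in> V" using Suc.prems(3) m by auto
  obtain B where B: "geodesic_segment V d (c a) (c m) B" using segment_exists cV by blast
  obtain C where C: "geodesic_segment V d (c m) (c b) C" using segment_exists cV by blast
  have "\<exists>w\<in>C \<union> B. d u w \<le> \<delta>"
    using slim Suc.prems(5,6) segment_sym[OF B] segment_sym[OF C]
    unfolding slim_triangles_def by blast
  then obtain w where w: "w \<in> C \<union> B" "d u w \<le> \<delta>" by blast
  have near: "\<exists>i. a \<le> i \<and> i \<le> b \<and> d w (c i) \<le> \<delta> * k + s"
  proof (cases "w \<in> B")
    case True
    have "\<exists>i. a \<le> i \<and> i \<le> m \<and> d w (c i) \<le> \<delta> * k + s"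
      by (rule Suc.IH[OF m(1) m(3) _ _ B True]) (use Suc.prems m in auto)
    then show ?thesis using m by auto
  next
    case False
    then have wC: "w \<in> C" using w by auto
    have "\<exists>i. m \<le> i \<and> i \<le> b \<and> d w (c i) \<le> \<delta> * k + s"
      by (rule Suc.IH[OF m(2) m(4) _ _ C wC]) (use Suc.prems m in auto)
    then show ?thesis using m(1) by (meson le_trans)
  qed
  then obtain i where i: "a \<le> i" "i \<le> b" "d w (c i) \<le> \<delta> * k + s" by blast
  have "u \<in> V" "w \<in> V" "c i \<in> V"
    using segmentD(3)[OF Suc.prems(5)] segmentD(3)[OF B] segmentD(3)[OF C] w Suc.prems(3,6) i
    by auto
  then have "d u (c i) \<le> d u w + d w (c i)" by (rule dist_tri)
  then show ?case using i w by auto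
qed

lemma slim_quadrilateral:
  assumes slim: "slim_triangles V d \<delta>"
    and "geodesic_segment V d y z A" "geodesic_segment V d y y' B"
    and "geodesic_segment V d y' z' C" "geodesic_segment V d z' z D" and u: "u \<in> A"
  shows "\<exists>w \<in> B \<union> C \<union> D. d u w \<le> 2 * \<delta>"
proof -
  have "y' \<in> V" "z \<in> V" using segmentD assms by metis+
  then obtain E where E: "geodesic_segment V d y' z E" using segment_exists by blast
  have "\<exists>w\<in>E \<union> B. d u w \<le> \<delta>"
    using slim assms(2) segment_sym[OF E] segment_sym[OF assms(3)] u
    unfolding slim_triangles_def by blast
  then obtain w where w: "w \<in> E \<union> B" "d u w \<le> \<delta>" by blast
  show ?thesis
  proof (cases "w \<in> B")
    case True
    then show ?thesis using w by (intro bexI[of _ w]) auto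
  next
    case False
    then have "w \<in> E" using w by auto
    then have "\<exists>v\<in>D \<union> C. d w v \<le> \<delta>"
      using slim E segment_sym[OF assms(5)] segment_sym[OF assms(4)]
      unfolding slim_triangles_def by blast
    then obtain v where v: "v \<in> D \<union> C" "d w v \<le> \<delta>" by blast
    have "u \<in> V" "w \<in> V" "v \<in> V"
      using segmentD(3)[OF assms(2)] segmentD(3)[OF assms(4)] segmentD(3)[OF assms(5)]
        segmentD(3)[OF E] u v \<open>w \<in> E\<close> by auto
    then have "d u v \<le> d u w + d w v" by (rule dist_tri)
    then show ?thesis using v w by (intro bexI[of _ v]) auto
  qed
qed

end

lemma exponential_beats_linear:
  "\<exists>k0::nat. \<forall>k\<ge>k0. A + B * k < 2 ^ k"
proof -
  \<comment> \<open>At \<open>k = 3 * n\<close> the left side is quadratic in \<open>n\<close>, and \<open>2 ^ k = (2 ^ n) ^ 3\<close> exceeds a cube.\<close>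
  define n where "n = A + B + 1"
  have "n + 3 * n * n \<le> (n + 1) ^ 3" by (simp add: power3_eq_cube algebra_simps)
  also have "\<dots> \<le> (2 ^ n) ^ 3" by (rule power_mono) (simp_all add: Suc_leI)
  also have "\<dots> = 2 ^ (3 * n)" by (simp add: power_mult[symmetric] mult.commute)
  finally have *: "n + 3 * n * n \<le> 2 ^ (3 * n)" .
  have "A + B * (3 * n) < n + n * (3 * n)"
    unfolding n_def by (intro add_less_le_mono mult_le_mono) auto
  then have base: "A + B * (3 * n) < 2 ^ (3 * n)" using * by (simp add: algebra_simps)
  have B: "B \<le> 2 ^ (3 * n)" using * by (simp add: n_def)
  have "A + B * k < 2 ^ k" if "k \<ge> 3 * n" for k
    using that
  proof (induction k rule: dec_induct)
    case base
    show ?case by fact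
  next
    case (step k)
    have "B \<le> 2 ^ k" 
      by (rule le_trans[OF B]) (simp add: step.hyps power_increasing)
    then show ?case using step.IH by simp
  qed
  then show ?thesis by blast
qed

text \<open>
  A number bounded by a linear function of the logarithm of itself is bounded; the logarithm enters
  through the exponents \<open>k\<close> with \<open>c * D + e \<le> 2 ^ k\<close>.
\<close>

lemma logarithmic_bound:
  "\<exists>D0::nat. \<forall>D::nat. (\<forall>k. c * D + e \<le> 2 ^ k \<longrightarrow> D \<le> a + b * k) \<longrightarrow> D \<le> D0"
proof -
  obtain k0 where k0: "\<And>k. k \<ge> k0 \<Longrightarrow> 2 * (c * a + c * b + e) + 2 * (c * b) * k < 2 ^ k"
    using exponential_beats_linear[of "2 * (c * a + c * b + e)" "2 * (c * b)"] by blast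
  have "D \<le> a + b * k0 + b" if D: "\<forall>k. c * D + e \<le> 2 ^ k \<longrightarrow> D \<le> a + b * k" for D
  proof -
    \<comment> \<open>By minimality \<open>2 ^ (k - 1) < c * D + e\<close>, which is at most linear in \<open>k\<close>; so \<open>k\<close> is bounded.\<close>
    define k where "k = (LEAST k. c * D + e \<le> 2 ^ k)"
    have ex: "c * D + e \<le> 2 ^ (c * D + e)" by (simp add: less_imp_le)
    have k: "c * D + e \<le> 2 ^ k" unfolding k_def by (rule LeastI) (rule ex)
    then have Dk: "D \<le> a + b * k" using D by blast
    have "k \<le> k0"
    proof (rule ccontr)
      assume "\<not> k \<le> k0"
      then obtain l where l: "k = Suc l" "l \<ge> k0" by (cases k) auto
      have "\<not> c * D + e \<le> 2 ^ l" using not_less_Least[of l "\<lambda>k. c * D + e \<le> 2 ^ k"] l unfolding k_def by auto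
      then have "2 ^ l < c * D + e" by simp
      also have "\<dots> \<le> c * (a + b * k) + e" using Dk by simp
      also have "\<dots> \<le> 2 * (c * a + c * b + e) + 2 * (c * b) * l"
        unfolding l by (simp add: algebra_simps)
      finally show False using k0[OF l(2)] by simp
    qed
    then have "b * k \<le> b * k0" by simp
    then show ?thesis using Dk by linarith
  qed
  then show ?thesis by blast
qed

section \<open>The Morse lemma\<close>

text \<open>
  The images of geodesics under a quasi-isometric embedding have this form. The upper bound is asked
  only for consecutive points, where it makes the path a chain of bounded steps.
\<close>

definition quasi_geodesic :: "'v set \<Rightarrow> ('v \<Rightarrow> 'v \<Rightarrow> nat) \<Rightarrow> nat \<Rightarrow> (nat \<Rightarrow> 'v) \<Rightarrow> nat \<Rightarrow> bool" where
  "quasi_geodesic V d K c n \<longleftrightarrow>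
     (\<forall>i\<le>n. c i \<in> V) \<and> (\<forall>i<n. d (c i) (c (Suc i)) \<le> K) \<and>
     (\<forall>j\<le>n. \<forall>i\<le>j. j - i \<le> K * d (c i) (c j) + K)"

context geodesic_space begin

text \<open>
  First half of the Morse lemma. Let \<open>D\<close> be the largest distance to the quasi-geodesic from a point of
  the segment, attained at \<open>p t\<close>. Cut the segment at distance about \<open>2 * D\<close> on both sides of \<open>p t\<close> and
  join the cut points to points of the quasi-geodesic at distance at most \<open>D\<close>. The quadrilateral so
  obtained is slim, and \<open>p t\<close> is too far from the two short sides, hence it is close to the side that
  joins two points of the quasi-geodesic. These points are \<open>O(D)\<close> apart, so the quasi-geodesic spans
  \<open>O(D)\<close> steps between them and comes within \<open>O(log D)\<close> of that side. Thus \<open>D\<close> is at most \<open>O(log D)\<close>.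
\<close>

lemma segment_near_quasi_geodesic:
  assumes slim: "slim_triangles V d \<delta>"
  shows "\<exists>D0. \<forall>c n A u. quasi_geodesic V d K c n \<longrightarrow> geodesic_segment V d (c 0) (c n) A \<longrightarrow>
           u \<in> A \<longrightarrow> (\<exists>i\<le>n. d u (c i) \<le> D0)"
proof -
  obtain D0 where D0: "\<And>D. (\<forall>k. (6 * K) * D + (4 * K * \<delta> + 2 * K + K) \<le> 2 ^ k \<longrightarrow>
      D \<le> (2 * \<delta> + K) + \<delta> * k) \<Longrightarrow> D \<le> D0"
    using logarithmic_bound[of "6 * K" "4 * K * \<delta> + 2 * K + K" "2 * \<delta> + K" \<delta>] by blast
  have "\<exists>i\<le>n. d u (c i) \<le> D0"
    if c: "quasi_geodesic V d K c n" and A: "geodesic_segment V d (c 0) (c n) A" and u: "u \<in> A"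
    for c n A u
  proof -
    have cV: "\<And>i. i \<le> n \<Longrightarrow> c i \<in> V" and cstep: "\<And>i. i < n \<Longrightarrow> d (c i) (c (Suc i)) \<le> K"
      and clow: "\<And>i j. i \<le> j \<Longrightarrow> j \<le> n \<Longrightarrow> j - i \<le> K * d (c i) (c j) + K"
      using c unfolding quasi_geodesic_def by auto
    obtain p m where p: "\<And>i. i \<le> m \<Longrightarrow> p i \<in> V"
        "\<And>i j. i \<le> j \<Longrightarrow> j \<le> m \<Longrightarrow> d (p i) (p j) = j - i"
      and ends: "p 0 = c 0" "p m = c n" "A = p ` {..m}"
      using A unfolding geodesic_segment_def by blast
    \<comment> \<open>The least admissible bound is attained at some \<open>p t\<close>.\<close>
    define near where "near D \<longleftrightarrow> (\<forall>t\<le>m. \<exists>i\<le>n. d (p t) (c i) \<le> D)" for D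
    define D where "D = (LEAST D. near D)"
    have "near m"
      unfolding near_def
    proof (intro allI impI exI conjI)
      fix t assume t: "t \<le> m"
      have "d (p t) (c 0) = d (p 0) (p t)" using dist_sym p(1) ends t by (metis le0)
      then show "d (p t) (c 0) \<le> m" using p(2)[of 0 t] t by simp
    qed auto
    then have nearD: "near D" unfolding D_def by (rule LeastI)
    obtain t where t: "t \<le> m" and far: "\<And>i. i \<le> n \<Longrightarrow> D \<le> d (p t) (c i)"
    proof (cases D)
      case 0
      then show ?thesis using that[of 0] by simp
    next
      case (Suc D')
      then have "\<not> near D'" using not_less_Least[of D' near] unfolding D_def by simp
      then show ?thesis using that Suc unfolding near_def by (metis not_less_eq_eq)
    qed
    have "D \<le> (2 * \<delta> + K) + \<delta> * k"
      if k: "(6 * K) * D + (4 * K * \<delta> + 2 * K + K) \<le> 2 ^ k" for k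
    proof -
      \<comment> \<open>Points within \<open>D\<close> of a point at distance \<open>R\<close> from \<open>p t\<close> are more than \<open>2 * \<delta>\<close> away from \<open>p t\<close>.\<close>
      define R where "R = 2 * D + 2 * \<delta> + 1"
      define a where "a = t - R"
      define b where "b = min (t + R) m"
      have ab: "a \<le> t" "t \<le> b" "b \<le> m" "b - a \<le> 2 * R" unfolding a_def b_def using t by auto
      have V: "p a \<in> V" "p b \<in> V" "p t \<in> V" using p(1) ab by auto
      \<comment> \<open>If a cut point is an end of the segment, which happens also by truncated subtraction, the short
          side degenerates to a point.\<close>
      obtain i where i: "i \<le> n" "d (p a) (c i) \<le> D" "a = 0 \<Longrightarrow> c i = p a"
      proof (cases "a = 0")
        case True
        then have "c 0 = p a" using ends(1) by simp
        then show ?thesis using that[of 0] dist_self[OF V(1)] by simp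
      next
        case False
        obtain i where "i \<le> n" "d (p a) (c i) \<le> D"
          using nearD ab unfolding near_def by (meson le_trans)
        then show ?thesis using that[of i] False by simp
      qed
      obtain j where j: "j \<le> n" "d (p b) (c j) \<le> D" "b = m \<Longrightarrow> c j = p b"
      proof (cases "b = m")
        case True
        then have "c n = p b" using ends(2) by simp
        then show ?thesis using that[of n] dist_self[OF V(2)] by simp
      next
        case False
        obtain j where "j \<le> n" "d (p b) (c j) \<le> D"
          using nearD ab unfolding near_def by meson
        then show ?thesis using that[of j] False by simp
      qed
      have cij: "c i \<in> V" "c j \<in> V" using cV i j by auto
      obtain B1 where B1: "geodesic_segment V d (p a) (c i) B1" using segment_exists V cij by blast
      obtain B2 where B2: "geodesic_segment V d (c i) (c j) B2" using segment_exists cij by blast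
      obtain B3 where B3: "geodesic_segment V d (c j) (p b) B3" using segment_exists V cij by blast
      have seg: "geodesic_segment V d (p a) (p b) (p ` {a..b})"
        by (rule subsegment[of m]) (use p ab in auto)
      have "p t \<in> p ` {a..b}" using ab by auto
      then obtain w where w: "w \<in> B1 \<union> B2 \<union> B3" "d (p t) w \<le> 2 * \<delta>"
        using slim_quadrilateral[OF slim seg B1 B2 B3] by blast
      have wV: "w \<in> V" using w B1 B2 B3 segmentD(3) by blast
      consider "w \<in> B1" | "w \<in> B2" | "w \<in> B3" using w by blast
      then show ?thesis
      proof cases
        case 1
        show ?thesis
        proof (cases "a = 0")
          case True
          have "d (p a) w \<le> d (p a) (c i)" using segmentD(6)[OF B1 1] .
          then have "d (p a) w = 0" using i(3) True V dist_self by simp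
          moreover have "d (p t) (p a) \<le> d (p t) w + d w (p a)" using dist_tri V wV by blast
          ultimately have "d (p t) (p a) \<le> 2 * \<delta>" using w dist_sym[OF V(1) wV] by simp
          then show ?thesis using far[of i] i(1,3) True by simp
        next
          case False
          then have "t - a = R" unfolding a_def by auto
          then have "R = d (p a) (p t)" using p(2)[of a t] ab by simp
          also have "\<dots> \<le> d (p a) w + d w (p t)" using dist_tri V wV by blast
          also have "\<dots> \<le> D + 2 * \<delta>"
            using segmentD(6)[OF B1 1] i(2) w(2) dist_sym[OF V(3) wV] by simp
          finally show ?thesis unfolding R_def by simp
        qed
      next
        case 3
        show ?thesis
        proof (cases "b = m")
          case True
          have "d w (p b) \<le> d (c j) (p b)" using segmentD(7)[OF B3 3] .
          then have "d w (p b) = 0" using j(3) True V dist_self by simp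
          moreover have "d (p t) (p b) \<le> d (p t) w + d w (p b)" using dist_tri V wV by blast
          ultimately have "d (p t) (p b) \<le> 2 * \<delta>" using w by simp
          then show ?thesis using far[of j] j(1,3) True by simp
        next
          case False
          then have "b - t = R" unfolding b_def by auto
          then have "R = d (p t) (p b)" using p(2)[of t b] ab by simp
          also have "\<dots> \<le> d (p t) w + d w (p b)" using dist_tri V wV by blast
          also have "\<dots> \<le> D + 2 * \<delta>"
            using segmentD(7)[OF B3 3] j(2) w(2) dist_sym[OF V(2) cij(2)] by simp
          finally show ?thesis unfolding R_def by simp
        qed
      next
        case 2
        have "d (c i) (c j) \<le> d (c i) (p a) + d (p a) (c j)" using dist_tri V cij by blast
        moreover have "d (p a) (c j) \<le> d (p a) (p b) + d (p b) (c j)" using dist_tri V cij by blast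
        ultimately have "d (c i) (c j) \<le> 2 * D + 2 * R"
          using i(2) j(2) p(2)[of a b] ab dist_sym[OF V(1) cij(1)] by simp
        then have "K * d (c i) (c j) + K \<le> K * (2 * D + 2 * R) + K" by simp
        also have "\<dots> \<le> 2 ^ k" using k unfolding R_def by (simp add: algebra_simps)
        finally have Kk: "K * d (c i) (c j) + K \<le> 2 ^ k" .
        define a' where "a' = min i j"
        define b' where "b' = max i j"
        have le: "a' \<le> b'" "b' \<le> n" unfolding a'_def b'_def using i j by auto
        have dab: "d (c a') (c b') = d (c i) (c j)"
          unfolding a'_def b'_def using dist_sym[OF cij] by (auto simp: min_def max_def)
        have "b' - a' \<le> 2 ^ k" using clow[OF le] Kk unfolding dab by linarith
        moreover have "geodesic_segment V d (c a') (c b') B2"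
          unfolding a'_def b'_def using B2 segment_sym[OF B2] by (auto simp: min_def max_def)
        ultimately have "\<exists>l. a' \<le> l \<and> l \<le> b' \<and> d w (c l) \<le> \<delta> * k + K"
          using le cV cstep 2 by (intro chain_near_segment[OF slim]) auto
        then obtain l where l: "l \<le> n" "d w (c l) \<le> \<delta> * k + K"
          using le by (meson le_trans)
        have "d (p t) (c l) \<le> d (p t) w + d w (c l)" using dist_tri V wV cV[OF l(1)] by blast
        then show ?thesis using far[OF l(1)] l(2) w(2) by linarith
      qed
    qed
    then have "D \<le> D0" using D0 by blast
    moreover obtain s where "s \<le> m" "u = p s" using u ends by auto
    ultimately show ?thesis using nearD unfolding near_def by (metis le_trans)
  qed
  then show ?thesis by blast
qed

text \<open>
  Second half of the Morse lemma, from the first: going along the segment, the nearby points of the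
  quasi-geodesic must at some moment jump from before time \<open>l\<close> to after it. The two points of the jump
  are close to each other, so only boundedly many steps separate them from time \<open>l\<close>.
\<close>

lemma quasi_geodesic_near_segment:
  assumes slim: "slim_triangles V d \<delta>"
  shows "\<exists>D1. \<forall>c n A l. quasi_geodesic V d K c n \<longrightarrow> geodesic_segment V d (c 0) (c n) A \<longrightarrow>
           l \<le> n \<longrightarrow> (\<exists>w\<in>A. d (c l) w \<le> D1)"
proof -
  obtain D0 where D0: "\<And>c n A u. quasi_geodesic V d K c n \<Longrightarrow>
      geodesic_segment V d (c 0) (c n) A \<Longrightarrow> u \<in> A \<Longrightarrow> \<exists>i\<le>n. d u (c i) \<le> D0"
    using segment_near_quasi_geodesic[OF slim] by metis
  have "\<exists>w\<in>A. d (c l) w \<le> K * (K * (2 * D0 + 1) + K) + D0"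
    if c: "quasi_geodesic V d K c n" and A: "geodesic_segment V d (c 0) (c n) A" and l: "l \<le> n"
    for c n A l
  proof -
    have cV: "\<And>i. i \<le> n \<Longrightarrow> c i \<in> V" and cstep: "\<And>i. i < n \<Longrightarrow> d (c i) (c (Suc i)) \<le> K"
      and clow: "\<And>i j. i \<le> j \<Longrightarrow> j \<le> n \<Longrightarrow> j - i \<le> K * d (c i) (c j) + K"
      using c unfolding quasi_geodesic_def by auto
    obtain p m where p: "\<And>i. i \<le> m \<Longrightarrow> p i \<in> V"
        "\<And>i j. i \<le> j \<Longrightarrow> j \<le> m \<Longrightarrow> d (p i) (p j) = j - i"
      and ends: "p 0 = c 0" "p m = c n" "A = p ` {..m}"
      using A unfolding geodesic_segment_def by blast
    \<comment> \<open>Take the last point of the segment that is close to the path before time \<open>l\<close>. The next point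
        is then close to the path after time \<open>l\<close>.\<close>
    define left where "left t \<longleftrightarrow> t \<le> m \<and> (\<exists>i\<le>l. d (p t) (c i) \<le> D0)" for t
    have "left 0" unfolding left_def using ends cV dist_self by (intro conjI exI[of _ 0]) auto
    moreover have "\<forall>t. left t \<longrightarrow> t \<le> m" unfolding left_def by blast
    ultimately obtain t where t: "left t" and last: "\<And>t'. left t' \<Longrightarrow> t' \<le> t"
      using GreatestI_nat[of left 0 m] Greatest_le_nat[of left _ m] by blast
    obtain i where i: "i \<le> l" "d (p t) (c i) \<le> D0" "t \<le> m" using t unfolding left_def by blast
    obtain j where j: "l \<le> j" "j \<le> n" "d (p t) (c j) \<le> D0 + 1"
    proof (cases "t = m")
      case True
      then show ?thesis using that[of n] l ends cV dist_self by simp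
    next
      case False
      then have tm: "Suc t \<le> m" using i(3) by simp
      then obtain j where j: "j \<le> n" "d (p (Suc t)) (c j) \<le> D0" using D0[OF c A] ends by blast
      have "\<not> left (Suc t)" using last by fastforce
      then have "\<not> j \<le> l" using j tm unfolding left_def by blast
      moreover have "d (p t) (c j) \<le> d (p t) (p (Suc t)) + d (p (Suc t)) (c j)"
        using dist_tri p(1) tm cV j by simp
      moreover have "d (p t) (p (Suc t)) = 1" using p(2)[of t "Suc t"] tm by simp
      ultimately show ?thesis using that[of j] j by simp
    qed
    have V: "p t \<in> V" "c i \<in> V" "c j \<in> V" "c l \<in> V" using p(1) cV i j l by auto
    have "d (c i) (c j) \<le> d (c i) (p t) + d (p t) (c j)" using dist_tri V by blast
    then have "d (c i) (c j) \<le> 2 * D0 + 1" using i j dist_sym[OF V(1,2)] by simp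
    then have "K * d (c i) (c j) + K \<le> K * (2 * D0 + 1) + K" using mult_le_mono2 add_le_mono1 by blast
    then have "l - i \<le> K * (2 * D0 + 1) + K" using clow[of i j] i j by linarith
    moreover have "d (c i) (c l') \<le> K * (l' - i)" if "i \<le> l'" "l' \<le> n" for l'
      using that
    proof (induction l' rule: dec_induct)
      case base
      then show ?case using V dist_self by simp
    next
      case (step l')
      have "d (c i) (c (Suc l')) \<le> d (c i) (c l') + d (c l') (c (Suc l'))"
        using dist_tri V cV step by simp
      then show ?case using step cstep[of l'] by (simp add: Suc_diff_le)
    qed
    ultimately have "d (c i) (c l) \<le> K * (K * (2 * D0 + 1) + K)"
      using i l by (meson le_trans mult_le_mono2)
    moreover have "d (c l) (p t) \<le> d (c l) (c i) + d (c i) (p t)" using dist_tri V by blast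
    ultimately have "d (c l) (p t) \<le> K * (K * (2 * D0 + 1) + K) + D0"
      using i dist_sym[OF V(1,2)] dist_sym[OF V(2,4)] by simp
    then show ?thesis using ends i(3) by blast
  qed
  then show ?thesis by blast
qed

end

text \<open>
  A geodesic triangle is mapped to a triangle of quasi-geodesics, which by the two halves of the Morse
  lemma is within bounded distance of a geodesic triangle; slimness of the latter is pulled back.
\<close>

lemma slim_triangles_quasi_isometric_embedding:
  assumes X: "geodesic_space V d" and Y: "geodesic_space V' d'"
    and slim: "slim_triangles V' d' \<delta>"
    and f: "\<And>x. x \<in> V \<Longrightarrow> f x \<in> V'"
    and up: "\<And>x y. x \<in> V \<Longrightarrow> y \<in> V \<Longrightarrow> d' (f x) (f y) \<le> K * d x y"
    and low: "\<And>x y. x \<in> V \<Longrightarrow> y \<in> V \<Longrightarrow> d x y \<le> K * d' (f x) (f y) + K"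
  shows "\<exists>\<delta>'. slim_triangles V d \<delta>'"
proof -
  interpret X: geodesic_space V d by fact
  interpret Y: geodesic_space V' d' by fact
  obtain D0 where D0: "\<And>c n A u. quasi_geodesic V' d' K c n \<Longrightarrow>
      geodesic_segment V' d' (c 0) (c n) A \<Longrightarrow> u \<in> A \<Longrightarrow> \<exists>i\<le>n. d' u (c i) \<le> D0"
    using Y.segment_near_quasi_geodesic[OF slim] by metis
  obtain D1 where D1: "\<And>c n A l. quasi_geodesic V' d' K c n \<Longrightarrow>
      geodesic_segment V' d' (c 0) (c n) A \<Longrightarrow> l \<le> n \<Longrightarrow> \<exists>w\<in>A. d' (c l) w \<le> D1"
    using Y.quasi_geodesic_near_segment[OF slim] by metis
  have side: "\<exists>n c. quasi_geodesic V' d' K c n \<and> c 0 = f x \<and> c n = f y \<and> f ` A = c ` {..n}"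
    if A: "geodesic_segment V d x y A" for x y A
  proof -
    obtain p n where p: "\<And>i. i \<le> n \<Longrightarrow> p i \<in> V"
        "\<And>i j. i \<le> j \<Longrightarrow> j \<le> n \<Longrightarrow> d (p i) (p j) = j - i"
      and ends: "p 0 = x" "p n = y" "A = p ` {..n}"
      using A unfolding geodesic_segment_def by blast
    have "quasi_geodesic V' d' K (\<lambda>i. f (p i)) n"
      unfolding quasi_geodesic_def
    proof (intro conjI allI impI)
      fix i assume i: "i < n"
      show "d' (f (p i)) (f (p (Suc i))) \<le> K"
        using up[of "p i" "p (Suc i)"] p(1)[of i] p(1)[of "Suc i"] p(2)[of i "Suc i"] i by simp
    next
      fix i j assume ij: "j \<le> n" "i \<le> j"
      then show "j - i \<le> K * d' (f (p i)) (f (p j)) + K"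
        using low[of "p i" "p j"] p(1)[of i] p(1)[of j] p(2)[of i j] by simp
    qed (use p f in auto)
    then show ?thesis using ends by (intro exI[of _ n] exI[of _ "\<lambda>i. f (p i)"]) (auto simp: image_image)
  qed
  have to_seg: "\<exists>w\<in>A'. d' (f u) w \<le> D1"
    if A: "geodesic_segment V d x y A" and A': "geodesic_segment V' d' (f x) (f y) A'" and u: "u \<in> A"
    for x y A A' u
  proof -
    obtain n c where c: "quasi_geodesic V' d' K c n" "c 0 = f x" "c n = f y" "f ` A = c ` {..n}"
      using side[OF A] by blast
    then obtain i where "i \<le> n" "f u = c i" using u by (metis atMost_iff imageE imageI)
    then show ?thesis using D1[OF c(1), of A' i] A' c by auto
  qed
  have from_seg: "\<exists>u\<in>A. d' w (f u) \<le> D0"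
    if A: "geodesic_segment V d x y A" and A': "geodesic_segment V' d' (f x) (f y) A'" and w: "w \<in> A'"
    for x y A A' w
  proof -
    obtain n c where c: "quasi_geodesic V' d' K c n" "c 0 = f x" "c n = f y" "f ` A = c ` {..n}"
      using side[OF A] by blast
    obtain i where i: "i \<le> n" "d' w (c i) \<le> D0" using D0[OF c(1) _ w] A' c by auto
    then have "c i \<in> f ` A" using c by blast
    then show ?thesis using i by auto
  qed
  have "slim_triangles V d (K * (D1 + \<delta> + D0) + K)"
    unfolding slim_triangles_def
  proof (intro allI impI ballI)
    fix x y z A B C u
    assume A: "geodesic_segment V d x y A" and B: "geodesic_segment V d y z B"
      and C: "geodesic_segment V d z x C" and u: "u \<in> A"
    have V: "x \<in> V" "y \<in> V" "z \<in> V" using X.segmentD A B by metis+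
    obtain A' where A': "geodesic_segment V' d' (f x) (f y) A'"
      using Y.segment_exists f V by blast
    obtain B' where B': "geodesic_segment V' d' (f y) (f z) B'"
      using Y.segment_exists f V by blast
    obtain C' where C': "geodesic_segment V' d' (f z) (f x) C'"
      using Y.segment_exists f V by blast
    obtain a where a: "a \<in> A'" "d' (f u) a \<le> D1" using to_seg[OF A A' u] by blast
    obtain b where b: "b \<in> B' \<union> C'" "d' a b \<le> \<delta>"
      using slim A' B' C' a(1) unfolding slim_triangles_def by blast
    have "\<exists>w\<in>B \<union> C. d' b (f w) \<le> D0"
      using from_seg[OF B B'] from_seg[OF C C'] b(1) by blast
    then obtain w where w: "w \<in> B \<union> C" "d' b (f w) \<le> D0" by blast
    have uw: "u \<in> V" "w \<in> V" using X.segmentD(3) A B C u w(1) by blast+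
    have V': "f u \<in> V'" "f w \<in> V'" "a \<in> V'" "b \<in> V'"
      using uw f Y.segmentD(3) A' B' C' a(1) b(1) by blast+
    have "d' (f u) (f w) \<le> d' (f u) a + d' a (f w)" using Y.dist_tri V' by blast
    moreover have "d' a (f w) \<le> d' a b + d' b (f w)" using Y.dist_tri V' by blast
    ultimately have "d' (f u) (f w) \<le> D1 + \<delta> + D0" using a b w by simp
    then have "d u w \<le> K * (D1 + \<delta> + D0) + K"
      using low[OF uw] by (meson add_le_mono1 le_trans mult_le_mono2)
    then show "\<exists>w\<in>B \<union> C. d u w \<le> K * (D1 + \<delta> + D0) + K" using w by blast
  qed
  then show ?thesis by blast
qed

section \<open>Connected graphs as geodesic spaces\<close>

lemma INF_enat_le_attained:
  fixes f :: "'a \<Rightarrow> enat"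
  assumes "(INF b\<in>B. f b) \<le> enat n"
  shows "\<exists>b\<in>B. f b \<le> enat n"
proof -
  have "B \<noteq> {}" using assms by (auto simp: top_enat_def)
  then obtain b where "f b \<in> f ` B" by blast
  then have "(INF b\<in>B. f b) \<in> f ` B" by (rule wellorder_InfI)
  then show ?thesis using assms by auto
qed

lemma graph_dist_le_iff: "graph_dist E x y \<le> enat n \<longleftrightarrow> (\<exists>m\<le>n. (x, y) \<in> E ^^ m)"
proof
  assume "graph_dist E x y \<le> enat n"
  then have "\<exists>m\<in>{m. (x, y) \<in> E ^^ m}. enat m \<le> enat n"
    unfolding graph_dist_def by (rule INF_enat_le_attained)
  then show "\<exists>m\<le>n. (x, y) \<in> E ^^ m" by auto
next
  assume "\<exists>m\<le>n. (x, y) \<in> E ^^ m"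
  then obtain m where "m \<le> n" "(x, y) \<in> E ^^ m" by blast
  then have "graph_dist E x y \<le> enat m" unfolding graph_dist_def by (intro INF_lower) simp
  then show "graph_dist E x y \<le> enat n" using \<open>m \<le> n\<close> by (meson enat_ord_simps(1) order_trans)
qed

lemma graph_dist_edge: "(x, y) \<in> E \<Longrightarrow> graph_dist E x y \<le> enat 1"
  unfolding graph_dist_le_iff by (intro exI[of _ 1]) auto

lemma graph_dist_trans:
  assumes "graph_dist E x y \<le> enat m" "graph_dist E y z \<le> enat n"
  shows "graph_dist E x z \<le> enat (m + n)"
proof -
  obtain k l where "k \<le> m" "(x, y) \<in> E ^^ k" "l \<le> n" "(y, z) \<in> E ^^ l"
    using assms unfolding graph_dist_le_iff by blast
  then show ?thesis
    unfolding graph_dist_le_iff by (intro exI[of _ "k + l"]) (auto intro: relpow_trans)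
qed

lemma relpow_sym: "sym E \<Longrightarrow> (x, y) \<in> E ^^ n \<Longrightarrow> (y, x) \<in> E ^^ n"
proof (induction n arbitrary: y)
  case (Suc n)
  then show ?case by (meson relpow_Suc_E relpow_Suc_I2 symD)
qed auto

lemma graph_dist_sym: "sym E \<Longrightarrow> graph_dist E x y \<le> enat n \<Longrightarrow> graph_dist E y x \<le> enat n"
  unfolding graph_dist_le_iff using relpow_sym[of E x y] by blast

text \<open>
  Stated for the extended distance, so that it applies also to graphs with deleted vertices, which
  need not be connected.
\<close>

lemma graph_dist_lipschitz:
  assumes edges: "\<And>x y. (x, y) \<in> E \<Longrightarrow> graph_dist E' (f x) (f y) \<le> enat K"
    and "graph_dist E x y \<le> enat n"
  shows "graph_dist E' (f x) (f y) \<le> enat (K * n)"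
proof -
  have walk: "graph_dist E' (f x) (f y) \<le> enat (K * m)" if "(x, y) \<in> E ^^ m" for m
    using that
  proof (induction m arbitrary: y)
    case 0
    then show ?case unfolding graph_dist_le_iff by auto
  next
    case (Suc m)
    then obtain z where "(x, z) \<in> E ^^ m" "(z, y) \<in> E" by auto
    then have "graph_dist E' (f x) (f y) \<le> enat (K * m + K)"
      using Suc.IH edges graph_dist_trans by metis
    then show ?case by (simp add: add.commute)
  qed
  obtain m where m: "m \<le> n" "(x, y) \<in> E ^^ m" using assms(2) unfolding graph_dist_le_iff by blast
  have "enat (K * m) \<le> enat (K * n)" using m(1) by simp
  then show ?thesis using walk[OF m(2)] by (rule order_trans[rotated])
qed

definition path_dist :: "('v \<times> 'v) set \<Rightarrow> 'v \<Rightarrow> 'v \<Rightarrow> nat" where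
  "path_dist E x y = the_enat (graph_dist E x y)"

locale connected_graph =
  fixes V :: "'v set" and E :: "('v \<times> 'v) set"
  assumes edges_verts: "E \<subseteq> V \<times> V" and edges_sym: "sym E" and conn: "graph_connected V E"
begin

lemma graph_dist_eq: "x \<in> V \<Longrightarrow> y \<in> V \<Longrightarrow> graph_dist E x y = enat (path_dist E x y)"
proof -
  assume "x \<in> V" "y \<in> V"
  then obtain n where "(x, y) \<in> E ^^ n"
    using conn rtrancl_imp_relpow unfolding graph_connected_def by blast
  then have "graph_dist E x y \<le> enat n" unfolding graph_dist_le_iff by blast
  then show ?thesis unfolding path_dist_def by (cases "graph_dist E x y") auto
qed

lemma path_dist_le_iff: "x \<in> V \<Longrightarrow> y \<in> V \<Longrightarrow> path_dist E x y \<le> n \<longleftrightarrow> graph_dist E x y \<le> enat n"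
  by (simp add: graph_dist_eq)

lemma path_dist_edge:
  assumes "(x, y) \<in> E"
  shows "path_dist E x y \<le> 1"
proof -
  have "x \<in> V" "y \<in> V" using assms edges_verts by auto
  then show ?thesis using graph_dist_edge[OF assms] by (simp add: path_dist_le_iff)
qed

lemma path_dist_triangle:
  assumes "x \<in> V" "y \<in> V" "z \<in> V"
  shows "path_dist E x z \<le> path_dist E x y + path_dist E y z"
  using graph_dist_trans[of E x y "path_dist E x y" z "path_dist E y z"]
  by (simp add: graph_dist_eq assms)

lemma path_dist_walk:
  assumes "\<And>i. i < n \<Longrightarrow> (p i, p (Suc i)) \<in> E" and "i \<le> j" "j \<le> n"
  shows "graph_dist E (p i) (p j) \<le> enat (j - i)"
proof -
  have "(p i, p j) \<in> E ^^ (j - i)"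
    unfolding relpow_fun_conv by (rule exI[of _ "\<lambda>k. p (i + k)"]) (use assms in auto)
  then show ?thesis unfolding graph_dist_le_iff by blast
qed

sublocale geodesic_space V "path_dist E"
proof
  fix x y z
  show "path_dist E x x = 0" if "x \<in> V"
  proof -
    have "graph_dist E x x \<le> enat 0" unfolding graph_dist_le_iff by auto
    then show ?thesis using that by (simp add: graph_dist_eq)
  qed
  show "path_dist E x y = path_dist E y x" if "x \<in> V" "y \<in> V"
  proof (rule order_antisym)
    show "path_dist E x y \<le> path_dist E y x"
      using graph_dist_sym[OF edges_sym, of y x] that by (simp add: graph_dist_eq)
    show "path_dist E y x \<le> path_dist E x y"
      using graph_dist_sym[OF edges_sym, of x y] that by (simp add: graph_dist_eq)
  qed
  show "path_dist E x z \<le> path_dist E x y + path_dist E y z" if "x \<in> V" "y \<in> V" "z \<in> V"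
    using path_dist_triangle that .
  show "\<exists>A. geodesic_segment V (path_dist E) x y A" if xy: "x \<in> V" "y \<in> V"
  proof -
    define n where "n = path_dist E x y"
    have "graph_dist E x y \<le> enat n" using xy by (simp add: graph_dist_eq n_def)
    then obtain m where m: "m \<le> n" "(x, y) \<in> E ^^ m" unfolding graph_dist_le_iff by blast
    have "graph_dist E x y \<le> enat m" using m(2) unfolding graph_dist_le_iff by blast
    then have "m = n" using m(1) xy by (simp add: graph_dist_eq n_def)
    then obtain p where p: "p 0 = x" "p n = y" "\<And>i. i < n \<Longrightarrow> (p i, p (Suc i)) \<in> E"
      using m(2) unfolding relpow_fun_conv by blast
    have pV: "p i \<in> V" if "i \<le> n" for i
    proof (cases i)
      case 0
      then show ?thesis using p xy by simp
    next
      case (Suc k)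
      then show ?thesis using p(3)[of k] that edges_verts by auto
    qed
    have le: "path_dist E (p i) (p j) \<le> j - i" if "i \<le> j" "j \<le> n" for i j
      using path_dist_walk[of n p i j] p(3) that path_dist_le_iff pV by simp
    have "path_dist E (p i) (p j) = j - i" if ij: "i \<le> j" "j \<le> n" for i j
    proof -
      have "n \<le> path_dist E (p 0) (p i) + path_dist E (p i) (p n)"
        using path_dist_triangle[of "p 0" "p i" "p n"] p(1,2) pV[of i] ij xy unfolding n_def by simp
      also have "path_dist E (p i) (p n) \<le> path_dist E (p i) (p j) + path_dist E (p j) (p n)"
        using path_dist_triangle pV ij by simp
      finally show ?thesis using le[of 0 i] le[of j n] le[of i j] ij by simp
    qed
    then show ?thesis
      unfolding geodesic_segment_def using pV p by (intro exI[of _ "p ` {..n}"] exI[of _ p] exI[of _ n]) auto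
  qed
qed

lemma geodesic_segment_if_geodesic:
  assumes "is_geodesic V E x y l"
  shows "geodesic_segment V (path_dist E) x y (set l)"
proof -
  from assms have l: "l \<noteq> []" "set l \<subseteq> V" "hd l = x" "last l = y"
    and dist: "\<And>i j. j < length l \<Longrightarrow> i \<le> j \<Longrightarrow> graph_dist E (l ! i) (l ! j) = enat (j - i)"
    unfolding is_geodesic_def by auto
  have "{..length l - 1} = {..<length l}" using l(1) by (cases l) auto
  then have "set l = (!) l ` {..length l - 1}" by (auto simp: set_conv_nth)
  moreover have "path_dist E (l ! i) (l ! j) = j - i" if "j < length l" "i \<le> j" for i j
    using dist[OF that] unfolding path_dist_def by simp
  moreover have "i < length l" if "i \<le> length l - 1" for i
    using that l(1) by (cases l) auto
  ultimately show ?thesis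
    unfolding geodesic_segment_def using l
    by (intro exI[of _ "(!) l"] exI[of _ "length l - 1"]) (auto simp: hd_conv_nth last_conv_nth)
qed

lemma geodesic_if_geodesic_segment:
  assumes "geodesic_segment V (path_dist E) x y A"
  shows "\<exists>l. is_geodesic V E x y l \<and> set l = A"
proof -
  obtain p n where p: "\<And>i. i \<le> n \<Longrightarrow> p i \<in> V"
      "\<And>i j. i \<le> j \<Longrightarrow> j \<le> n \<Longrightarrow> path_dist E (p i) (p j) = j - i"
    and ends: "p 0 = x" "p n = y" "A = p ` {..n}"
    using assms unfolding geodesic_segment_def by blast
  let ?l = "map p [0..<Suc n]"
  have "set ?l = A" using ends by (auto simp: less_Suc_eq_le simp del: upt_Suc)
  moreover have nth: "?l ! i = p i" if "i < Suc n" for i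
    using that by (simp del: upt_Suc)
  have "is_geodesic V E x y ?l"
    unfolding is_geodesic_def
  proof (intro conjI allI impI)
    show "set ?l \<subseteq> V" using p(1) by (auto simp: less_Suc_eq_le simp del: upt_Suc)
    show "hd ?l = x" using ends by (simp add: hd_map del: upt_Suc)
    show "last ?l = y" using ends by (simp add: last_map)
    fix i j assume "j < length ?l" "i \<le> j"
    then have ij: "j \<le> n" "i \<le> j" by auto
    then show "graph_dist E (?l ! i) (?l ! j) = enat (j - i)"
      using p nth by (simp add: graph_dist_eq del: upt_Suc)
  qed simp
  ultimately show ?thesis by blast
qed

lemma graph_hyperbolic_iff:
  "graph_hyperbolic V E \<longleftrightarrow> (\<exists>\<delta>. slim_triangles V (path_dist E) \<delta>)"
proof
  assume "graph_hyperbolic V E"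
  then obtain \<delta> :: nat where \<delta>: "\<And>x y z p q r u. \<lbrakk>x \<in> V; y \<in> V; z \<in> V; is_geodesic V E x y p;
      is_geodesic V E y z q; is_geodesic V E z x r; u \<in> set p\<rbrakk> \<Longrightarrow>
      \<exists>w\<in>set q \<union> set r. graph_dist E u w \<le> enat \<delta>"
    unfolding graph_hyperbolic_def by blast
  have "slim_triangles V (path_dist E) \<delta>"
    unfolding slim_triangles_def
  proof (intro allI impI ballI)
    fix x y z A B C u
    assume A: "geodesic_segment V (path_dist E) x y A" and B: "geodesic_segment V (path_dist E) y z B"
      and C: "geodesic_segment V (path_dist E) z x C" and u: "u \<in> A"
    obtain p where p: "is_geodesic V E x y p" "set p = A" using geodesic_if_geodesic_segment[OF A] by blast
    obtain q where q: "is_geodesic V E y z q" "set q = B" using geodesic_if_geodesic_segment[OF B] by blast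
    obtain r where r: "is_geodesic V E z x r" "set r = C" using geodesic_if_geodesic_segment[OF C] by blast
    have "\<exists>w\<in>set q \<union> set r. graph_dist E u w \<le> enat \<delta>"
      using \<delta>[OF _ _ _ p(1) q(1) r(1)] segmentD(1)[OF A] segmentD(1)[OF B] segmentD(1)[OF C] u p(2)
      by simp
    moreover have "u \<in> V" "set q \<union> set r \<subseteq> V"
      using segmentD(3)[OF A] segmentD(3)[OF B] segmentD(3)[OF C] u q(2) r(2) by auto
    ultimately show "\<exists>w\<in>B \<union> C. path_dist E u w \<le> \<delta>"
      using q(2) r(2) path_dist_le_iff by blast
  qed
  then show "\<exists>\<delta>. slim_triangles V (path_dist E) \<delta>" by blast
next
  assume "\<exists>\<delta>. slim_triangles V (path_dist E) \<delta>"
  then obtain \<delta> where \<delta>: "slim_triangles V (path_dist E) \<delta>" by blast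
  show "graph_hyperbolic V E"
    unfolding graph_hyperbolic_def
  proof (intro exI[of _ \<delta>] ballI allI impI)
    fix x y z p q r u
    assume "is_geodesic V E x y p" "is_geodesic V E y z q" "is_geodesic V E z x r" and u: "u \<in> set p"
    then have segs: "geodesic_segment V (path_dist E) x y (set p)"
        "geodesic_segment V (path_dist E) y z (set q)" "geodesic_segment V (path_dist E) z x (set r)"
      using geodesic_segment_if_geodesic by blast+
    obtain w where w: "w \<in> set q \<union> set r" "path_dist E u w \<le> \<delta>"
      using \<delta> segs u unfolding slim_triangles_def by blast
    moreover have "u \<in> V" "w \<in> V" using segmentD(3)[OF segs(1)] segmentD(3)[OF segs(2)] segmentD(3)[OF segs(3)] u w(1) by auto
    ultimately show "\<exists>w\<in>set q \<union> set r. graph_dist E u w \<le> enat \<delta>"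
      using path_dist_le_iff by blast
  qed
qed

end

section \<open>Coarse geometry of word metrics\<close>

text \<open>
  For nonempty sets this says that the Hausdorff distance is at most \<open>n\<close>.
\<close>

definition set_close :: "('v \<Rightarrow> 'v \<Rightarrow> nat) \<Rightarrow> nat \<Rightarrow> 'v set \<Rightarrow> 'v set \<Rightarrow> bool" where
  "set_close d n A B \<longleftrightarrow> (\<forall>a\<in>A. \<exists>b\<in>B. d a b \<le> n) \<and> (\<forall>b\<in>B. \<exists>a\<in>A. d a b \<le> n)"

definition coarsely_equal :: "'v set \<Rightarrow> ('v \<Rightarrow> 'v \<Rightarrow> nat) \<Rightarrow> 'v set \<Rightarrow> 'v set \<Rightarrow> bool" where
  "coarsely_equal V d A B \<longleftrightarrow> A \<subseteq> V \<and> B \<subseteq> V \<and> (\<exists>n. set_close d n A B)"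

lemma coarsely_equalI: "A \<subseteq> V \<Longrightarrow> B \<subseteq> V \<Longrightarrow> set_close d n A B \<Longrightarrow> coarsely_equal V d A B"
  unfolding coarsely_equal_def by blast

lemma coarsely_equal_closed: "coarsely_equal V d A B \<Longrightarrow> A \<subseteq> V" "coarsely_equal V d A B \<Longrightarrow> B \<subseteq> V"
  unfolding coarsely_equal_def by blast+

context geodesic_space begin

lemma set_close_refl:
  assumes "A \<subseteq> V"
  shows "set_close d n A A"
proof -
  have "d a a \<le> n" if "a \<in> A" for a using dist_self assms that by (simp add: subsetD)
  then show ?thesis unfolding set_close_def by blast
qed

lemma set_close_sym:
  assumes "A \<subseteq> V" "B \<subseteq> V" "set_close d n A B"
  shows "set_close d n B A"
proof -
  have "d a b = d b a" if "a \<in> A" "b \<in> B" for a b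
    using dist_sym assms(1,2) that by blast
  then show ?thesis using assms(3) unfolding set_close_def by fastforce
qed

lemma set_close_trans:
  assumes V: "A \<subseteq> V" "B \<subseteq> V" "C \<subseteq> V" and AB: "set_close d m A B" and BC: "set_close d n B C"
  shows "set_close d (m + n) A C"
  unfolding set_close_def
proof (intro conjI ballI)
  fix a assume a: "a \<in> A"
  obtain b where b: "b \<in> B" "d a b \<le> m" using AB a unfolding set_close_def by blast
  obtain c where c: "c \<in> C" "d b c \<le> n" using BC b(1) unfolding set_close_def by blast
  have "d a c \<le> d a b + d b c" using dist_tri V a b c by blast
  then show "\<exists>c\<in>C. d a c \<le> m + n" using b c by (intro bexI[of _ c]) auto
next
  fix c assume c: "c \<in> C"
  obtain b where b: "b \<in> B" "d b c \<le> n" using BC c unfolding set_close_def by blast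
  obtain a where a: "a \<in> A" "d a b \<le> m" using AB b(1) unfolding set_close_def by blast
  have "d a c \<le> d a b + d b c" using dist_tri V a b c by blast
  then show "\<exists>a\<in>A. d a c \<le> m + n" using a b by (intro bexI[of _ a]) auto
qed

lemma coarsely_equal_refl: "A \<subseteq> V \<Longrightarrow> coarsely_equal V d A A"
  using set_close_refl[of A 0] unfolding coarsely_equal_def by blast

lemma coarsely_equal_sym:
  assumes "coarsely_equal V d A B"
  shows "coarsely_equal V d B A"
  using assms set_close_sym[of A B] unfolding coarsely_equal_def by blast

lemma coarsely_equal_trans [trans]:
  assumes "coarsely_equal V d A B" "coarsely_equal V d B C"
  shows "coarsely_equal V d A C"
  using assms set_close_trans[of A B C] unfolding coarsely_equal_def by blast

end

lemma set_close_mono: "set_close d m A B \<Longrightarrow> m \<le> n \<Longrightarrow> set_close d n A B"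
  unfolding set_close_def using le_trans by blast

context group begin

lemma cancel_inv:
  assumes "x \<in> carrier G" "y \<in> carrier G"
  shows "x \<otimes> (inv x \<otimes> y) = y" "inv x \<otimes> (x \<otimes> y) = y"
  using assms by (simp_all add: m_assoc[symmetric])

lemma mem_conjugate_iff:
  assumes "g \<in> carrier G" "A \<subseteq> carrier G"
  shows "x \<in> conjugate G g A \<longleftrightarrow> x \<in> carrier G \<and> inv g \<otimes> x \<otimes> g \<in> A"
proof
  assume "x \<in> conjugate G g A"
  then obtain a where a: "a \<in> A" "x = g \<otimes> a \<otimes> inv g"
    unfolding conjugate_def l_coset_def r_coset_def by auto
  then have "a \<in> carrier G" using assms by auto
  then have "x \<in> carrier G" "inv g \<otimes> x \<otimes> g = a"
    using assms(1) unfolding a(2) by (simp_all add: m_assoc cancel_inv)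
  then show "x \<in> carrier G \<and> inv g \<otimes> x \<otimes> g \<in> A" using a by simp
next
  assume x: "x \<in> carrier G \<and> inv g \<otimes> x \<otimes> g \<in> A"
  have "x = g \<otimes> (inv g \<otimes> x \<otimes> g) \<otimes> inv g"
    using assms x by (simp add: m_assoc cancel_inv)
  then show "x \<in> conjugate G g A"
    unfolding conjugate_def l_coset_def r_coset_def using x by blast
qed

lemma conjugate_closed: "g \<in> carrier G \<Longrightarrow> A \<subseteq> carrier G \<Longrightarrow> conjugate G g A \<subseteq> carrier G"
  by (simp add: subset_iff mem_conjugate_iff)

lemma conjugate_one:
  assumes "A \<subseteq> carrier G"
  shows "conjugate G \<one> A = A"
proof (rule Set.set_eqI)
  fix x
  show "x \<in> conjugate G \<one> A \<longleftrightarrow> x \<in> A"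
    using mem_conjugate_iff[OF one_closed assms, of x] assms by (cases "x \<in> carrier G") auto
qed

lemma subgroup_conjugate: "g \<in> carrier G \<Longrightarrow> subgroup P G \<Longrightarrow> subgroup (conjugate G g P) G"
  unfolding conjugate_def by (rule subgroup_conjugation_is_surj2)

lemma finite_index_in_iff: "finite_index_in G K P \<longleftrightarrow> finite ((\<lambda>a. K #> a) ` P)"
  unfolding finite_index_in_def RCOSETS_def by (simp add: UNION_singleton_eq_range)

end

locale generated_group = group G for G (structure) +
  fixes S
  assumes gen: "generating_set G S"
begin

lemma generators_closed: "S \<subseteq> carrier G"
  using gen unfolding generating_set_def by blast

lemma cayley_walk:
  assumes "x \<in> generate G S" "g \<in> carrier G"
  shows "(g, g \<otimes> x) \<in> (cayley_edges G S)\<^sup>*"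
  using assms
proof (induction arbitrary: g rule: generate.induct)
  case one
  then show ?case by simp
next
  case (incl h)
  then have "(g, g \<otimes> h) \<in> cayley_edges G S" unfolding cayley_edges_def by blast
  then show ?case by blast
next
  case (inv h)
  then have "h \<in> carrier G" using generators_closed by blast
  then have "(g, g \<otimes> inv h) = ((g \<otimes> inv h) \<otimes> h, g \<otimes> inv h)" "g \<otimes> inv h \<in> carrier G"
    using inv by (simp_all add: m_assoc)
  then have "(g, g \<otimes> inv h) \<in> cayley_edges G S" unfolding cayley_edges_def using inv(1) by blast
  then show ?case by blast
next
  case (eng h1 h2)
  have "h1 \<in> carrier G" "h2 \<in> carrier G"
    using eng gen unfolding generating_set_def by blast+
  then show ?case using eng.IH(1)[of g] eng.IH(2)[of "g \<otimes> h1"] eng.prems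
    by (simp add: m_assoc) 
qed

sublocale cayley: connected_graph "carrier G" "cayley_edges G S"
proof
  show "cayley_edges G S \<subseteq> carrier G \<times> carrier G"
    unfolding cayley_edges_def using generators_closed by auto
  show "sym (cayley_edges G S)" unfolding cayley_edges_def by (auto intro!: symI)
  show "graph_connected (carrier G) (cayley_edges G S)"
    unfolding graph_connected_def
  proof (intro ballI)
    fix x y assume x: "x \<in> carrier G" and y: "y \<in> carrier G"
    have "inv x \<otimes> y \<in> generate G S" using gen x y unfolding generating_set_def by simp
    from cayley_walk[OF this x] show "(x, y) \<in> (cayley_edges G S)\<^sup>*"
      using x y by (simp add: cancel_inv)
  qed
qed

abbreviation dist_S :: "'a \<Rightarrow> 'a \<Rightarrow> nat" where
  "dist_S \<equiv> path_dist (cayley_edges G S)"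

lemma dist_translate_le:
  assumes g: "g \<in> carrier G" and x: "x \<in> carrier G" and y: "y \<in> carrier G"
  shows "dist_S (g \<otimes> x) (g \<otimes> y) \<le> dist_S x y"
proof -
  have "graph_dist (cayley_edges G S) (g \<otimes> x) (g \<otimes> y) \<le> enat (1 * dist_S x y)"
  proof (rule graph_dist_lipschitz[where f = "\<lambda>x. g \<otimes> x"])
    fix a b assume "(a, b) \<in> cayley_edges G S"
    then obtain h s where h: "h \<in> carrier G" "s \<in> S" "(a, b) = (h, h \<otimes> s) \<or> (a, b) = (h \<otimes> s, h)"
      unfolding cayley_edges_def by blast
    then have "(g \<otimes> a, g \<otimes> b) = (g \<otimes> h, (g \<otimes> h) \<otimes> s) \<or> (g \<otimes> a, g \<otimes> b) = ((g \<otimes> h) \<otimes> s, g \<otimes> h)"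
      using g generators_closed by (auto simp: m_assoc)
    then have "(g \<otimes> a, g \<otimes> b) \<in> cayley_edges G S"
      unfolding cayley_edges_def using g h by blast
    then show "graph_dist (cayley_edges G S) (g \<otimes> a) (g \<otimes> b) \<le> enat 1"
      by (rule graph_dist_edge)
  qed (simp add: cayley.graph_dist_eq x y)
  then show ?thesis using g x y by (simp add: cayley.graph_dist_eq)
qed

lemma dist_translate:
  assumes g: "g \<in> carrier G" and x: "x \<in> carrier G" and y: "y \<in> carrier G"
  shows "dist_S (g \<otimes> x) (g \<otimes> y) = dist_S x y"
proof (rule order_antisym)
  show "dist_S x y \<le> dist_S (g \<otimes> x) (g \<otimes> y)"
    using dist_translate_le[of "inv g" "g \<otimes> x" "g \<otimes> y"] g x y by (simp add: cancel_inv)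
qed (rule dist_translate_le[OF assms])

lemma dist_right_mult:
  assumes "x \<in> carrier G" "g \<in> carrier G"
  shows "dist_S x (x \<otimes> g) = dist_S \<one> g"
  using dist_translate[of x \<one> g] assms by simp

lemma set_close_translate:
  assumes g: "g \<in> carrier G" and A: "A \<subseteq> carrier G" and B: "B \<subseteq> carrier G"
    and close: "set_close dist_S n A B"
  shows "set_close dist_S n (g <# A) (g <# B)"
proof -
  have tr: "dist_S (g \<otimes> a) (g \<otimes> b) = dist_S a b" if "a \<in> A" "b \<in> B" for a b
    using dist_translate g A B that by blast
  have coset: "g <# C = (\<lambda>c. g \<otimes> c) ` C" for C unfolding l_coset_def by auto
  show ?thesis
    unfolding set_close_def coset
  proof (intro conjI ballI)
    fix x assume "x \<in> (\<lambda>c. g \<otimes> c) ` A"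
    then obtain a where a: "a \<in> A" "x = g \<otimes> a" by blast
    then obtain b where "b \<in> B" "dist_S a b \<le> n" using close unfolding set_close_def by blast
    then show "\<exists>y\<in>(\<lambda>c. g \<otimes> c) ` B. dist_S x y \<le> n" using tr a by (auto intro!: bexI[of _ b])
  next
    fix y assume "y \<in> (\<lambda>c. g \<otimes> c) ` B"
    then obtain b where b: "b \<in> B" "y = g \<otimes> b" by blast
    then obtain a where "a \<in> A" "dist_S a b \<le> n" using close unfolding set_close_def by blast
    then show "\<exists>x\<in>(\<lambda>c. g \<otimes> c) ` A. dist_S x y \<le> n" using tr b by (auto intro!: bexI[of _ a])
  qed
qed

lemma coarsely_equal_translate:
  assumes "g \<in> carrier G" "coarsely_equal (carrier G) dist_S A B"
  shows "coarsely_equal (carrier G) dist_S (g <# A) (g <# B)"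
  using assms set_close_translate[of g A B] l_coset_subset_G[of A g] l_coset_subset_G[of B g]
  unfolding coarsely_equal_def by blast

lemma set_close_right_translate:
  assumes g: "g \<in> carrier G" and A: "A \<subseteq> carrier G"
  shows "set_close dist_S (dist_S \<one> g) A (A #> g)"
proof -
  have *: "dist_S a (a \<otimes> g) \<le> dist_S \<one> g" if "a \<in> A" for a
    using dist_right_mult g A that by (simp add: subset_iff)
  show ?thesis unfolding set_close_def r_coset_def using * by fastforce
qed

lemma coarsely_equal_conjugate:
  assumes g: "g \<in> carrier G" and A: "A \<subseteq> carrier G"
  shows "coarsely_equal (carrier G) dist_S (g <# A) (conjugate G g A)"
proof (rule coarsely_equalI)
  show gA: "g <# A \<subseteq> carrier G" by (rule l_coset_subset_G[OF A g])
  show "conjugate G g A \<subseteq> carrier G" by (rule conjugate_closed[OF g A])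
  show "set_close dist_S (dist_S \<one> (inv g)) (g <# A) (conjugate G g A)"
    unfolding conjugate_def by (rule set_close_right_translate[OF inv_closed[OF g] gA])
qed

end

locale finitely_generated_group = generated_group +
  assumes finite_generators: "finite S"
begin

lemma finite_ball:
  assumes x: "x \<in> carrier G"
  shows "finite {y \<in> carrier G. dist_S x y \<le> n}"
proof -
  have fin: "finite {y. (z, y) \<in> cayley_edges G S}" if "z \<in> carrier G" for z
  proof (rule finite_subset)
    show "{y. (z, y) \<in> cayley_edges G S} \<subseteq> (\<lambda>s. z \<otimes> s) ` S \<union> (\<lambda>s. z \<otimes> inv s) ` S"
    proof
      fix y assume "y \<in> {y. (z, y) \<in> cayley_edges G S}"
      then consider s where "s \<in> S" "y = z \<otimes> s" | s where "s \<in> S" "z = y \<otimes> s" "y \<in> carrier G"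
        unfolding cayley_edges_def by blast
      then show "y \<in> (\<lambda>s. z \<otimes> s) ` S \<union> (\<lambda>s. z \<otimes> inv s) ` S"
      proof cases
        case 2
        then have "s \<in> carrier G" using generators_closed by blast
        then have "y = z \<otimes> inv s" using 2 by (simp add: m_assoc)
        then show ?thesis using 2 by blast
      qed blast
    qed
  qed (use finite_generators in simp)
  have sphere: "finite {y. (x, y) \<in> cayley_edges G S ^^ m}" for m
  proof (induction m)
    case (Suc m)
    have "{y. (x, y) \<in> cayley_edges G S ^^ Suc m} =
          (\<Union>z\<in>{z. (x, z) \<in> cayley_edges G S ^^ m}. {y. (z, y) \<in> cayley_edges G S})" by auto
    moreover have "finite {y. (z, y) \<in> cayley_edges G S}" for z
    proof (cases "z \<in> carrier G")
      case False
      then have "{y. (z, y) \<in> cayley_edges G S} = {}" using cayley.edges_verts by blast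
      then show ?thesis by simp
    qed (rule fin)
    ultimately show ?case using Suc by simp
  qed simp
  have "{y \<in> carrier G. dist_S x y \<le> n} \<subseteq> (\<Union>m\<le>n. {y. (x, y) \<in> cayley_edges G S ^^ m})"
    using x by (auto simp: cayley.path_dist_le_iff graph_dist_le_iff)
  then show ?thesis by (rule finite_subset) (simp add: sphere)
qed

text \<open>
  Write each element \<open>p\<close> of \<open>P\<close> as \<open>k \<otimes> u\<close> with \<open>k \<in> Q\<close> and \<open>u\<close> in the ball of radius \<open>n\<close>. If two
  elements have the same \<open>u\<close>, their quotient lies in \<open>P \<inter> Q\<close>; so the finite ball bounds the number of
  cosets of \<open>P \<inter> Q\<close> in \<open>P\<close>.
\<close>

lemma finite_index_if_near:
  assumes P: "subgroup P G" and Q: "subgroup Q G"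
    and near: "\<And>p. p \<in> P \<Longrightarrow> \<exists>k\<in>Q. dist_S p k \<le> n"
  shows "finite_index_in G (P \<inter> Q) P"
proof -
  let ?K = "P \<inter> Q"
  interpret P: subgroup P G by fact
  interpret Q: subgroup Q G by fact
  have K: "subgroup ?K G" using subgroups_Inter_pair P Q by blast
  have "\<forall>p\<in>P. \<exists>k. k \<in> Q \<and> dist_S p k \<le> n" using near by blast
  then obtain k where k: "\<And>p. p \<in> P \<Longrightarrow> k p \<in> Q \<and> dist_S p (k p) \<le> n" by (meson bchoice)
  define u where "u p = inv (k p) \<otimes> p" for p
  have kG: "k p \<in> carrier G" if "p \<in> P" for p using k[OF that] by auto
  have ball: "u p \<in> {y \<in> carrier G. dist_S \<one> y \<le> n}" if p: "p \<in> P" for p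
  proof -
    have "dist_S \<one> (u p) = dist_S (k p) (k p \<otimes> u p)"
      using dist_right_mult kG p unfolding u_def by simp
    also have "k p \<otimes> u p = p" unfolding u_def using kG p by (simp add: cancel_inv)
    also have "dist_S (k p) p = dist_S p (k p)" using cayley.dist_sym kG p by simp
    finally show ?thesis using k[OF p] kG p unfolding u_def by simp
  qed
  have same: "?K #> p = ?K #> p'" if p: "p \<in> P" "p' \<in> P" and eq: "u p = u p'" for p p'
  proof -
    have "p \<otimes> inv p' = (k p \<otimes> u p) \<otimes> inv (k p' \<otimes> u p')"
      unfolding u_def using kG p by (simp add: cancel_inv)
    also have "\<dots> = k p \<otimes> inv (k p')"
      using ball[OF p(1)] ball[OF p(2)] kG[OF p(1)] kG[OF p(2)] unfolding eq
      by (simp add: inv_mult_group m_assoc cancel_inv)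
    also have "\<dots> \<in> Q" using k p by simp
    finally have "p \<otimes> inv p' \<in> ?K" using p by simp
    moreover have "p = (p \<otimes> inv p') \<otimes> p'" using p by (simp add: m_assoc)
    ultimately have "p \<in> ?K #> p'" unfolding r_coset_def by blast
    then show ?thesis using repr_independence[of p ?K p'] K p by simp
  qed
  define c where "c v = ?K #> (SOME p. p \<in> P \<and> u p = v)" for v
  have "(\<lambda>a. ?K #> a) ` P \<subseteq> c ` {y \<in> carrier G. dist_S \<one> y \<le> n}"
  proof
    fix C assume "C \<in> (\<lambda>a. ?K #> a) ` P"
    then obtain p where p: "p \<in> P" "C = ?K #> p" by blast
    have "(SOME p'. p' \<in> P \<and> u p' = u p) \<in> P \<and> u (SOME p'. p' \<in> P \<and> u p' = u p) = u p"
      by (rule someI[of _ p]) (use p in simp)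
    then have "C = c (u p)" unfolding c_def p(2) using same[of p "SOME p'. p' \<in> P \<and> u p' = u p"] p(1) by simp
    then show "C \<in> c ` {y \<in> carrier G. dist_S \<one> y \<le> n}" using ball[OF p(1)] by blast
  qed
  then show ?thesis
    unfolding finite_index_in_iff using finite_ball[of \<one> n] by (simp add: finite_subset)
qed

lemma near_if_finite_index:
  assumes P: "subgroup P G" and K: "subgroup K G" and fin: "finite_index_in G K P"
  shows "\<exists>n. \<forall>p\<in>P. \<exists>k\<in>K. dist_S p k \<le> n"
proof -
  interpret P: subgroup P G by fact
  interpret K: subgroup K G by fact
  obtain F where F: "finite F" "F \<subseteq> P" "(\<lambda>a. K #> a) ` P = (\<lambda>a. K #> a) ` F"
    using fin unfolding finite_index_in_iff by (meson finite_subset_image subset_refl)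
  have "\<exists>k\<in>K. dist_S p k \<le> Max (dist_S \<one> ` F)" if p: "p \<in> P" for p
  proof -
    obtain r where r: "r \<in> F" "K #> p = K #> r" using F(3) p by blast
    have rG: "r \<in> carrier G" using r(1) F(2) by auto
    have "p \<in> K #> r" using rcos_self[OF P.mem_carrier[OF p] K] r(2) by simp
    then obtain k where k: "k \<in> K" "p = k \<otimes> r" unfolding r_coset_def by auto
    have "dist_S p k = dist_S k p" using cayley.dist_sym p k(1) by simp
    also have "\<dots> = dist_S \<one> r" using dist_right_mult k rG by simp
    also have "\<dots> \<le> Max (dist_S \<one> ` F)" using r(1) F(1) by simp
    finally show ?thesis using k(1) by blast
  qed
  then show ?thesis by blast
qed

lemma commensurable_iff_coarsely_equal:
  assumes P: "subgroup P G" and Q: "subgroup Q G"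
  shows "commensurable G P Q \<longleftrightarrow> coarsely_equal (carrier G) dist_S P Q"
proof
  interpret P: subgroup P G by fact
  interpret Q: subgroup Q G by fact
  have K: "subgroup (P \<inter> Q) G" using subgroups_Inter_pair P Q by blast
  {
    assume c: "commensurable G P Q"
    obtain m where m: "\<forall>p\<in>P. \<exists>k\<in>P \<inter> Q. dist_S p k \<le> m"
      using near_if_finite_index[OF P K] c unfolding commensurable_def by blast
    obtain n where n: "\<forall>p\<in>Q. \<exists>k\<in>P \<inter> Q. dist_S p k \<le> n"
      using near_if_finite_index[OF Q K] c unfolding commensurable_def by blast
    have "set_close dist_S (m + n) P Q"
      unfolding set_close_def
    proof (intro conjI ballI)
      fix p assume "p \<in> P"
      then obtain k where "k \<in> P \<inter> Q" "dist_S p k \<le> m" using m by blast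
      then show "\<exists>b\<in>Q. dist_S p b \<le> m + n" by (intro bexI[of _ k]) auto
    next
      fix p assume p: "p \<in> Q"
      then obtain k where k: "k \<in> P \<inter> Q" "dist_S p k \<le> n" using n by blast
      then have "dist_S k p \<le> n" using cayley.dist_sym[of p k] p by simp
      then show "\<exists>a\<in>P. dist_S a p \<le> m + n" using k by (intro bexI[of _ k]) auto
    qed
    then show "coarsely_equal (carrier G) dist_S P Q" by (intro coarsely_equalI P.subset Q.subset)
  }
  assume "coarsely_equal (carrier G) dist_S P Q"
  then obtain n where n: "set_close dist_S n P Q" unfolding coarsely_equal_def by blast
  then have "finite_index_in G (P \<inter> Q) P"
    by (intro finite_index_if_near[OF P Q]) (auto simp: set_close_def)
  moreover have "set_close dist_S n Q P" using cayley.set_close_sym n P.subset Q.subset by blast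
  then have "finite_index_in G (Q \<inter> P) Q"
    by (intro finite_index_if_near[OF Q P]) (auto simp: set_close_def)
  ultimately show "commensurable G P Q" unfolding commensurable_def by (simp add: Int_commute)
qed

text \<open>
  Right multiplication by \<open>inv g\<close> moves points by a bounded distance, so \<open>g Q g\<inverse>\<close> is at finite
  Hausdorff distance from the coset \<open>g Q\<close>.
\<close>

lemma commensurable_conjugate_iff:
  assumes P: "subgroup P G" and Q: "subgroup Q G" and g: "g \<in> carrier G"
  shows "commensurable G P (conjugate G g Q) \<longleftrightarrow> coarsely_equal (carrier G) dist_S P (g <# Q)"
proof -
  have "coarsely_equal (carrier G) dist_S (g <# Q) (conjugate G g Q)"
    by (rule coarsely_equal_conjugate[OF g subgroup.subset[OF Q]])
  then have "coarsely_equal (carrier G) dist_S P (conjugate G g Q) \<longleftrightarrow>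
      coarsely_equal (carrier G) dist_S P (g <# Q)"
    using cayley.coarsely_equal_trans cayley.coarsely_equal_sym by blast
  then show ?thesis using commensurable_iff_coarsely_equal[OF P subgroup_conjugate[OF g Q]] by simp
qed

lemma mem_commensurator_iff:
  "subgroup P G \<Longrightarrow>
   g \<in> commensurator G P \<longleftrightarrow> g \<in> carrier G \<and> coarsely_equal (carrier G) dist_S P (g <# P)"
  using commensurable_conjugate_iff[of P P g] unfolding commensurator_def by auto

lemma subgroup_le_commensurator:
  assumes P: "subgroup P G"
  shows "P \<subseteq> commensurator G P"
proof
  fix p assume p: "p \<in> P"
  then have "p \<in> carrier G" using subgroup.subset[OF P] by blast
  moreover from this have "p <# P = P" using coset_join3 P p by blast
  ultimately show "p \<in> commensurator G P"
    using mem_commensurator_iff[OF P] cayley.coarsely_equal_refl subgroup.subset[OF P] by simp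
qed

lemma subgroup_commensurator:
  assumes P: "subgroup P G"
  shows "subgroup (commensurator G P) G"
proof
  note mem = mem_commensurator_iff[OF P] and sub = subgroup.subset[OF P]
  show "commensurator G P \<subseteq> carrier G" unfolding commensurator_def by blast
  show "\<one> \<in> commensurator G P" using subgroup_le_commensurator[OF P] subgroup.one_closed[OF P] by blast
  fix g assume "g \<in> commensurator G P"
  then have g: "g \<in> carrier G" "coarsely_equal (carrier G) dist_S P (g <# P)" using mem by auto
  have "coarsely_equal (carrier G) dist_S (inv g <# P) (inv g <# (g <# P))"
    by (rule coarsely_equal_translate[OF inv_closed[OF g(1)] g(2)])
  also have "inv g <# (g <# P) = P" using g(1) sub by (simp add: lcos_m_assoc lcos_mult_one)
  finally show "inv g \<in> commensurator G P" using mem g(1) cayley.coarsely_equal_sym by simp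
  fix h assume "h \<in> commensurator G P"
  then have h: "h \<in> carrier G" "coarsely_equal (carrier G) dist_S P (h <# P)" using mem by auto
  note g(2)
  also have "coarsely_equal (carrier G) dist_S (g <# P) (g <# (h <# P))"
    by (rule coarsely_equal_translate[OF g(1) h(2)])
  also have "g <# (h <# P) = (g \<otimes> h) <# P" using g(1) h(1) sub by (simp add: lcos_m_assoc)
  finally show "g \<otimes> h \<in> commensurator G P" using mem g(1) h(1) by simp
qed

lemma commensurator_cong:
  assumes P: "subgroup P G" and Q: "subgroup Q G" and PQ: "coarsely_equal (carrier G) dist_S P Q"
  shows "commensurator G P = commensurator G Q"
proof -
  have "coarsely_equal (carrier G) dist_S P (g <# P) \<longleftrightarrow> coarsely_equal (carrier G) dist_S Q (g <# Q)"
    if g: "g \<in> carrier G" for g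
  proof -
    have "coarsely_equal (carrier G) dist_S (g <# P) (g <# Q)"
      by (rule coarsely_equal_translate[OF g PQ])
    then show ?thesis using PQ cayley.coarsely_equal_trans cayley.coarsely_equal_sym by blast
  qed
  then show ?thesis using mem_commensurator_iff[OF P] mem_commensurator_iff[OF Q] by blast
qed

lemma commensurator_conjugate:
  assumes P: "subgroup P G" and x: "x \<in> carrier G"
  shows "commensurator G (conjugate G x P) = conjugate G x (commensurator G P)"
proof (rule Set.set_eqI)
  fix k
  note sub = subgroup.subset[OF P]
  have conj: "coarsely_equal (carrier G) dist_S (x <# P) (conjugate G x P)"
    by (rule coarsely_equal_conjugate[OF x sub])
  have "coarsely_equal (carrier G) dist_S (conjugate G x P) (k <# conjugate G x P) \<longleftrightarrow>
        coarsely_equal (carrier G) dist_S P ((inv x \<otimes> k \<otimes> x) <# P)" if k: "k \<in> carrier G"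
  proof -
    have kx: "coarsely_equal (carrier G) dist_S (k <# (x <# P)) (k <# conjugate G x P)"
      by (rule coarsely_equal_translate[OF k conj])
    have 1: "inv x <# (x <# P) = P" using x sub by (simp add: lcos_m_assoc lcos_mult_one)
    have 2: "inv x <# (k <# (x <# P)) = (inv x \<otimes> k \<otimes> x) <# P"
      using x k sub by (simp add: lcos_m_assoc m_assoc l_coset_subset_G)
    have 3: "x <# ((inv x \<otimes> k \<otimes> x) <# P) = k <# (x <# P)"
      using x k sub by (simp add: lcos_m_assoc m_assoc cancel_inv)
    have "coarsely_equal (carrier G) dist_S (conjugate G x P) (k <# conjugate G x P) \<longleftrightarrow>
          coarsely_equal (carrier G) dist_S (x <# P) (k <# (x <# P))"
      using conj kx cayley.coarsely_equal_trans cayley.coarsely_equal_sym by blast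
    also have "\<dots> \<longleftrightarrow> coarsely_equal (carrier G) dist_S P ((inv x \<otimes> k \<otimes> x) <# P)"
      using coarsely_equal_translate[of "inv x" "x <# P" "k <# (x <# P)"]
        coarsely_equal_translate[of x P "(inv x \<otimes> k \<otimes> x) <# P"] x
      unfolding 1 2 3 by auto
    finally show ?thesis .
  qed
  moreover have "k \<in> conjugate G x (commensurator G P) \<longleftrightarrow>
      k \<in> carrier G \<and> inv x \<otimes> k \<otimes> x \<in> commensurator G P"
    using mem_conjugate_iff[OF x] subgroup.subset[OF subgroup_commensurator[OF P]] by blast
  ultimately show "k \<in> commensurator G (conjugate G x P) \<longleftrightarrow> k \<in> conjugate G x (commensurator G P)"
    using mem_commensurator_iff[OF P] mem_commensurator_iff[OF subgroup_conjugate[OF x P]] x by auto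
qed

text \<open>
  The generators in the finite set \<open>S\<close> are words of bounded length in \<open>S'\<close>. Thus closeness in the
  metric of a finite generating set implies closeness in that of any other generating set.
\<close>

lemma dist_le_other_word_dist:
  assumes "generating_set G S'"
  shows "\<exists>K. \<forall>x\<in>carrier G. \<forall>y\<in>carrier G. path_dist (cayley_edges G S') x y \<le> K * dist_S x y"
proof -
  interpret S': generated_group G S' by unfold_locales fact
  let ?K = "Max (S'.dist_S \<one> ` S)"
  have K: "S'.dist_S \<one> s \<le> Max (S'.dist_S \<one> ` S)" if "s \<in> S" for s
    using finite_generators that by simp
  have "S'.dist_S x y \<le> ?K * dist_S x y" if xy: "x \<in> carrier G" "y \<in> carrier G" for x y
  proof -
    have "graph_dist (cayley_edges G S') x y \<le> enat (?K * dist_S x y)"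
    proof (rule graph_dist_lipschitz[where f = "\<lambda>x. x"])
      fix a b assume "(a, b) \<in> cayley_edges G S"
      then have ab: "a \<in> carrier G" "b \<in> carrier G" and
        "\<exists>s\<in>S. b = a \<otimes> s \<or> a = b \<otimes> s"
        using generators_closed unfolding cayley_edges_def by auto
      then obtain s where s: "s \<in> S" "b = a \<otimes> s \<or> a = b \<otimes> s" by blast
      then have "s \<in> carrier G" using generators_closed by blast
      then have "S'.dist_S a b = S'.dist_S \<one> s"
        using s(2) S'.dist_right_mult[OF ab(1), of s] S'.dist_right_mult[OF ab(2), of s]
          S'.cayley.dist_sym[OF ab] by auto
      then show "graph_dist (cayley_edges G S') a b \<le> enat ?K"
        using K[OF s(1)] ab by (simp add: S'.cayley.graph_dist_eq)
    qed (simp add: cayley.graph_dist_eq xy)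
    then show ?thesis using xy by (simp add: S'.cayley.graph_dist_eq)
  qed
  then show ?thesis by blast
qed

end

section \<open>Coned-off Cayley graphs\<close>

text \<open>
  Only \<open>W = {}\<close> (distances in the graph) and \<open>W = {v}\<close> (angles at \<open>v\<close>)
  occur in the end; one notation treats both at once.
\<close>

definition avoid :: "('v \<times> 'v) set \<Rightarrow> 'v set \<Rightarrow> ('v \<times> 'v) set" where
  "avoid E W = {(a, b) \<in> E. a \<notin> W \<and> b \<notin> W}"

lemma avoid_empty [simp]: "avoid E {} = E"
  unfolding avoid_def by simp

lemma sym_avoid: "sym E \<Longrightarrow> sym (avoid E W)"
  unfolding avoid_def by (auto intro!: symI dest: symD)

lemma angle_dist_eq: "angle_dist E v = graph_dist (avoid E {v})"
  unfolding angle_dist_def avoid_def by (intro ext) simp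

lemma left_cosets_iff: "A \<in> left_cosets G \<P> \<longleftrightarrow> (\<exists>P\<in>\<P>. \<exists>g\<in>carrier G. A = g <#\<^bsub>G\<^esub> P)"
  unfolding left_cosets_def LCOSETS_def by auto

lemma (in group) left_coset_translate:
  assumes "A \<in> left_cosets G \<P>" "g \<in> carrier G" "\<And>P. P \<in> \<P> \<Longrightarrow> P \<subseteq> carrier G"
  shows "g <# A \<in> left_cosets G \<P>"
proof -
  obtain P h where P: "P \<in> \<P>" "h \<in> carrier G" "A = h <# P"
    using assms(1) unfolding left_cosets_iff by blast
  then have "g <# A = (g \<otimes> h) <# P" using lcos_m_assoc assms(2,3) by simp
  then show ?thesis unfolding left_cosets_iff using P assms(2) by (intro bexI[of _ P] bexI[of _ "g \<otimes> h"]) auto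
qed

locale coned_off_group = generated_group G S for G (structure) and S +
  fixes \<P> :: "'a set set"
  assumes peripheral_closed: "P \<in> \<P> \<Longrightarrow> P \<subseteq> carrier G"
    and peripheral_nonempty: "P \<in> \<P> \<Longrightarrow> P \<noteq> {}"
begin

abbreviation cone_verts :: "('a + 'a set) set" where
  "cone_verts \<equiv> coned_off_verts G \<P>"

abbreviation cone_edges :: "(('a + 'a set) \<times> ('a + 'a set)) set" where
  "cone_edges \<equiv> coned_off_edges G \<P> S"

lemma coset_closed: "A \<in> left_cosets G \<P> \<Longrightarrow> A \<subseteq> carrier G"
  using l_coset_subset_G peripheral_closed unfolding left_cosets_iff by metis

lemma coset_nonempty: "A \<in> left_cosets G \<P> \<Longrightarrow> A \<noteq> {}"
  using peripheral_nonempty unfolding left_cosets_iff l_coset_def by fast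

lemma cayley_edge_cone_edge: "(x, y) \<in> cayley_edges G S \<Longrightarrow> (Inl x, Inl y) \<in> cone_edges"
  unfolding coned_off_edges_def by blast

lemma cone_edge: "A \<in> left_cosets G \<P> \<Longrightarrow> x \<in> A \<Longrightarrow> (Inl x, Inr A) \<in> cone_edges"
  unfolding coned_off_edges_def by blast

lemma cone_edge_cases:
  assumes "(u, v) \<in> cone_edges"
  obtains (cayley) x y where "u = Inl x" "v = Inl y" "(x, y) \<in> cayley_edges G S"
  | (to_cone) x A where "u = Inl x" "v = Inr A" "A \<in> left_cosets G \<P>" "x \<in> A"
  | (from_cone) x A where "u = Inr A" "v = Inl x" "A \<in> left_cosets G \<P>" "x \<in> A"
  using assms unfolding coned_off_edges_def by blast

lemma cone_link: "A \<in> left_cosets G \<P> \<Longrightarrow> graph_link cone_edges (Inr A) = Inl ` A"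
  unfolding graph_link_def coned_off_edges_def by blast

lemma cone_edges_sym: "sym cone_edges"
  using cayley.edges_sym unfolding coned_off_edges_def by (auto intro!: symI dest: symD)

text \<open>
  Paths in the Cayley graph pass through no cone vertex, so deleting cone vertices does not lengthen them.
\<close>

lemma graph_dist_avoid_le:
  assumes "x \<in> carrier G" "y \<in> carrier G" "W \<subseteq> range Inr"
  shows "graph_dist (avoid cone_edges W) (Inl x) (Inl y) \<le> enat (dist_S x y)"
proof -
  have "graph_dist (avoid cone_edges W) (Inl x) (Inl y) \<le> enat (1 * dist_S x y)"
  proof (rule graph_dist_lipschitz[where f = Inl])
    fix a b assume "(a, b) \<in> cayley_edges G S"
    then have "(Inl a, Inl b) \<in> avoid cone_edges W"
      using cayley_edge_cone_edge assms(3) unfolding avoid_def by blast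
    then show "graph_dist (avoid cone_edges W) (Inl a) (Inl b) \<le> enat 1" by (rule graph_dist_edge)
  qed (simp add: cayley.graph_dist_eq assms)
  then show ?thesis by simp
qed

sublocale cone: connected_graph cone_verts cone_edges
proof
  show "cone_edges \<subseteq> cone_verts \<times> cone_verts"
    using cayley.edges_verts coset_closed unfolding coned_off_verts_def
    by (auto elim!: cone_edge_cases)
  show "sym cone_edges" by (rule cone_edges_sym)
  have group_connected: "(Inl x, Inl y) \<in> cone_edges\<^sup>*" if "x \<in> carrier G" "y \<in> carrier G" for x y
  proof -
    have "graph_dist cone_edges (Inl x) (Inl y) \<le> enat (dist_S x y)"
      using graph_dist_avoid_le[of x y "{}"] that by simp
    then show ?thesis unfolding graph_dist_le_iff by (blast intro: relpow_imp_rtrancl)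
  qed
  have near_group: "\<exists>x\<in>carrier G. (u, Inl x) \<in> cone_edges\<^sup>*" if "u \<in> cone_verts" for u
  proof (cases u)
    case (Inl x)
    then show ?thesis using that unfolding coned_off_verts_def by auto
  next
    case (Inr A)
    then have A: "A \<in> left_cosets G \<P>" using that unfolding coned_off_verts_def by auto
    then obtain x where x: "x \<in> A" using coset_nonempty by blast
    have "(u, Inl x) \<in> cone_edges" using cone_edge[OF A x] cone_edges_sym Inr by (auto dest: symD)
    then show ?thesis using x coset_closed[OF A] by blast
  qed
  show "graph_connected cone_verts cone_edges"
    unfolding graph_connected_def
  proof (intro ballI)
    fix u v assume "u \<in> cone_verts" "v \<in> cone_verts"
    then obtain x y where x: "x \<in> carrier G" "(u, Inl x) \<in> cone_edges\<^sup>*"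
      and y: "y \<in> carrier G" "(v, Inl y) \<in> cone_edges\<^sup>*"
      using near_group by meson
    have "(Inl y, v) \<in> cone_edges\<^sup>*" using sym_rtrancl[OF cone_edges_sym] y(2) by (rule symD)
    then show "(u, v) \<in> cone_edges\<^sup>*" using x y group_connected by (meson rtrancl_trans)
  qed
qed

lemma hyperbolically_embedded_iff:
  "hyperbolically_embedded G \<P> S \<longleftrightarrow>
     (\<exists>\<delta>. slim_triangles cone_verts (path_dist cone_edges) \<delta>) \<and>
     (\<forall>A\<in>left_cosets G \<P>. fine_at cone_edges (Inr A))"
  unfolding hyperbolically_embedded_def using cone.conn cone.graph_hyperbolic_iff by simp

end

section \<open>Coarse equivalences of group pairs\<close>

definition coarsely_lipschitz ::
  "'a set \<Rightarrow> ('a \<Rightarrow> 'a \<Rightarrow> nat) \<Rightarrow> ('b \<Rightarrow> 'b \<Rightarrow> nat) \<Rightarrow> ('a \<Rightarrow> 'b) \<Rightarrow> bool" where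
  "coarsely_lipschitz X d d' f \<longleftrightarrow> (\<exists>K. \<forall>x\<in>X. \<forall>y\<in>X. d' (f x) (f y) \<le> K * d x y + K)"

definition coarse_inverse ::
  "'a set \<Rightarrow> ('a \<Rightarrow> 'a \<Rightarrow> nat) \<Rightarrow> ('b \<Rightarrow> 'a) \<Rightarrow> ('a \<Rightarrow> 'b) \<Rightarrow> bool" where
  "coarse_inverse X d g f \<longleftrightarrow> (\<exists>K. \<forall>x\<in>X. d (g (f x)) x \<le> K)"

definition coarsely_maps_into ::
  "('b \<Rightarrow> 'b \<Rightarrow> nat) \<Rightarrow> ('a \<Rightarrow> 'b) \<Rightarrow> 'a set set \<Rightarrow> 'b set set \<Rightarrow> bool" where
  "coarsely_maps_into d f \<A> \<B> \<longleftrightarrow> (\<exists>n. \<forall>A\<in>\<A>. \<exists>B\<in>\<B>. set_close d n (f ` A) B)"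

lemma set_close_image:
  assumes lip: "\<And>x y. x \<in> X \<Longrightarrow> y \<in> X \<Longrightarrow> d' (f x) (f y) \<le> K * d x y + K"
    and AB: "A \<subseteq> X" "B \<subseteq> X" "set_close d n A B"
  shows "set_close d' (K * n + K) (f ` A) (f ` B)"
proof -
  have *: "d' (f a) (f b) \<le> K * n + K" if "a \<in> A" "b \<in> B" "d a b \<le> n" for a b
  proof -
    have "d' (f a) (f b) \<le> K * d a b + K" using lip AB that by blast
    also have "\<dots> \<le> K * n + K" using that by simp
    finally show ?thesis .
  qed
  show ?thesis
    unfolding set_close_def
  proof (intro conjI ballI)
    fix y assume "y \<in> f ` A"
    then obtain a where a: "a \<in> A" "y = f a" by blast
    then obtain b where "b \<in> B" "d a b \<le> n" using AB(3) unfolding set_close_def by blast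
    then show "\<exists>z\<in>f ` B. d' y z \<le> K * n + K" using * a by blast
  next
    fix z assume "z \<in> f ` B"
    then obtain b where b: "b \<in> B" "z = f b" by blast
    then obtain a where "a \<in> A" "d a b \<le> n" using AB(3) unfolding set_close_def by blast
    then show "\<exists>y\<in>f ` A. d' y z \<le> K * n + K" using * b by blast
  qed
qed

lemma set_close_inverse_image:
  assumes "\<And>x. x \<in> A \<Longrightarrow> d (g (f x)) x \<le> K"
  shows "set_close d K (g ` f ` A) A"
  using assms unfolding set_close_def by auto

locale group_pair = coned_off_group G S \<P> + fin: finitely_generated_group G S0
  for G (structure) and S0 S \<P>

context group_pair begin

definition separated_cosets :: bool where
  "separated_cosets \<longleftrightarrow> (\<forall>A\<in>left_cosets G \<P>. \<forall>A'\<in>left_cosets G \<P>.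
     coarsely_equal (carrier G) fin.dist_S A A' \<longrightarrow> A = A')"

lemma separated_cosetsD:
  "separated_cosets \<Longrightarrow> A \<in> left_cosets G \<P> \<Longrightarrow> A' \<in> left_cosets G \<P> \<Longrightarrow>
   coarsely_equal (carrier G) fin.dist_S A A' \<Longrightarrow> A = A'"
  unfolding separated_cosets_def by blast

lemma separated_cosetsI:
  assumes subgroups: "\<And>P. P \<in> \<P> \<Longrightarrow> subgroup P G"
    and red: "\<And>P P' h. P \<in> \<P> \<Longrightarrow> P' \<in> \<P> \<Longrightarrow> h \<in> carrier G \<Longrightarrow>
      coarsely_equal (carrier G) fin.dist_S P (h <# P') \<Longrightarrow> P = P' \<and> h \<in> P"
  shows separated_cosets
  unfolding separated_cosets_def
proof (intro ballI impI)
  fix A A' assume "A \<in> left_cosets G \<P>" "A' \<in> left_cosets G \<P>"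
    and AA': "coarsely_equal (carrier G) fin.dist_S A A'"
  then obtain P g P' g' where P: "P \<in> \<P>" "g \<in> carrier G" "A = g <# P"
    and P': "P' \<in> \<P>" "g' \<in> carrier G" "A' = g' <# P'"
    unfolding left_cosets_iff by blast
  have sub: "P \<subseteq> carrier G" "P' \<subseteq> carrier G" using peripheral_closed P P' by blast+
  let ?h = "inv g \<otimes> g'"
  have h: "?h \<in> carrier G" using P P' by simp
  have "coarsely_equal (carrier G) fin.dist_S (inv g <# A) (inv g <# A')"
    by (rule fin.coarsely_equal_translate[OF inv_closed[OF P(2)] AA'])
  moreover have "inv g <# A = P" "inv g <# A' = ?h <# P'"
    using P P' sub by (simp_all add: lcos_m_assoc lcos_mult_one)
  ultimately have "coarsely_equal (carrier G) fin.dist_S P (?h <# P')" by simp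
  then have eq: "P = P' \<and> ?h \<in> P" by (rule red[OF P(1) P'(1) h])
  then have "?h <# P = P" using coset_join3[OF h subgroups[OF P(1)]] by blast
  moreover have "g <# (?h <# P) = g' <# P" using P P' sub by (simp add: lcos_m_assoc cancel_inv)
  ultimately show "A = A'" using P(3) P'(3) eq by simp
qed

lemma separated_cosets_if_reduced:
  assumes subgroups: "\<And>P. P \<in> \<P> \<Longrightarrow> subgroup P G" and "reduced G \<P>"
  shows separated_cosets
proof (rule separated_cosetsI[OF subgroups])
  fix P P' h assume P: "P \<in> \<P>" "P' \<in> \<P>" "h \<in> carrier G"
    "coarsely_equal (carrier G) fin.dist_S P (h <# P')"
  then have "commensurable G P (conjugate G h P')"
    using fin.commensurable_conjugate_iff subgroups by blast
  then show "P = P' \<and> h \<in> P" using assms(2) P unfolding reduced_def by blast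
qed

lemma infinite_coset:
  assumes "\<And>P. P \<in> \<P> \<Longrightarrow> infinite P" "A \<in> left_cosets G \<P>"
  shows "infinite A"
proof -
  obtain P g where P: "P \<in> \<P>" "g \<in> carrier G" "A = g <# P"
    using assms(2) unfolding left_cosets_iff by blast
  have "A = (\<lambda>p. g \<otimes> p) ` P" using P(3) unfolding l_coset_def by auto
  moreover have "inj_on (\<lambda>p. g \<otimes> p) P"
    using inj_on_cmult[OF P(2)] peripheral_closed[OF P(1)] inj_on_subset by blast
  ultimately show ?thesis using assms(1)[OF P(1)] finite_imageD by blast
qed

text \<open>
  If two distinct cosets \<open>A\<close> and \<open>B\<close> were close, then any two points of the infinite set \<open>A\<close> would
  be joined by a path of bounded length through the cone vertex of \<open>B\<close> that misses the cone vertex of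
  \<open>A\<close>, against fineness at the latter.
\<close>

lemma separated_cosets_if_fine:
  assumes inf: "\<And>P. P \<in> \<P> \<Longrightarrow> infinite P"
    and fine: "\<And>A. A \<in> left_cosets G \<P> \<Longrightarrow> fine_at cone_edges (Inr A)"
  shows separated_cosets
  unfolding separated_cosets_def
proof (intro ballI impI, rule ccontr)
  fix A B assume A: "A \<in> left_cosets G \<P>" and B: "B \<in> left_cosets G \<P>"
    and close: "coarsely_equal (carrier G) fin.dist_S A B" and "A \<noteq> B"
  let ?E = "avoid cone_edges {Inr A}"
  obtain n where n: "set_close fin.dist_S n A B" using close unfolding coarsely_equal_def by blast
  obtain K where K: "\<And>x y. x \<in> carrier G \<Longrightarrow> y \<in> carrier G \<Longrightarrow> dist_S x y \<le> K * fin.dist_S x y"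
    using fin.dist_le_other_word_dist[OF gen] by blast
  have sub: "A \<subseteq> carrier G" "B \<subseteq> carrier G" using coset_closed A B by blast+
  have to_B: "graph_dist ?E (Inl a) (Inr B) \<le> enat (K * n + 1)" if a: "a \<in> A" for a
  proof -
    obtain b where b: "b \<in> B" "fin.dist_S a b \<le> n" using n a unfolding set_close_def by blast
    have ab: "a \<in> carrier G" "b \<in> carrier G" using sub a b by blast+
    have "dist_S a b \<le> K * fin.dist_S a b" using K ab by blast
    also have "\<dots> \<le> K * n" using b(2) by simp
    finally have "enat (dist_S a b) \<le> enat (K * n)" by simp
    with graph_dist_avoid_le[OF ab] have 1: "graph_dist ?E (Inl a) (Inl b) \<le> enat (K * n)"
      by (rule order_trans) auto
    have "(Inl b, Inr B) \<in> ?E" using cone_edge[OF B b(1)] \<open>A \<noteq> B\<close> unfolding avoid_def by auto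
    then show ?thesis using graph_dist_trans[OF 1 graph_dist_edge] by blast
  qed
  obtain x where x: "x \<in> A" using coset_nonempty[OF A] by blast
  let ?R = "(K * n + 1) + (K * n + 1)"
  have "graph_dist ?E (Inl x) (Inl a) \<le> enat ?R" if "a \<in> A" for a
    by (rule graph_dist_trans[OF to_B[OF x] graph_dist_sym[OF sym_avoid[OF cone_edges_sym] to_B[OF that]]])
  then have "Inl ` A \<subseteq> {v \<in> graph_link cone_edges (Inr A). angle_dist cone_edges (Inr A) (Inl x) v \<le> enat ?R}"
    unfolding cone_link[OF A] angle_dist_eq by blast
  moreover have "finite {v \<in> graph_link cone_edges (Inr A). angle_dist cone_edges (Inr A) (Inl x) v \<le> enat ?R}"
    using fine[OF A] x unfolding fine_at_def cone_link[OF A] by blast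
  ultimately have "finite (Inl ` A :: ('a + 'a set) set)" by (rule finite_subset)
  then have "finite A" by (rule finite_imageD) simp
  then show False using infinite_coset[OF inf A] by blast
qed

end

text \<open>
  A quasi-isometry of pairs together with a quasi-inverse, in a form that is symmetric under exchanging
  the two sides. Correspondence of cosets and quasi-inverseness are measured in the metrics of the
  finite generating sets; this is the stronger condition.
\<close>

locale pair_equivalence = G: group_pair G S0 S \<P> + H: group_pair H T0 T \<Q>
  for G :: "('a, 'm) monoid_scheme" and S0 S \<P>
    and H :: "('b, 'n) monoid_scheme" and T0 T \<Q> +
  fixes q :: "'a \<Rightarrow> 'b" and r :: "'b \<Rightarrow> 'a"
  assumes q_closed: "x \<in> carrier G \<Longrightarrow> q x \<in> carrier H"
    and r_closed: "y \<in> carrier H \<Longrightarrow> r y \<in> carrier G"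
    and q_lipschitz_fin: "coarsely_lipschitz (carrier G) G.fin.dist_S H.fin.dist_S q"
    and r_lipschitz_fin: "coarsely_lipschitz (carrier H) H.fin.dist_S G.fin.dist_S r"
    and q_lipschitz: "coarsely_lipschitz (carrier G) G.dist_S H.dist_S q"
    and r_lipschitz: "coarsely_lipschitz (carrier H) H.dist_S G.dist_S r"
    and rq: "coarse_inverse (carrier G) G.fin.dist_S r q"
    and qr: "coarse_inverse (carrier H) H.fin.dist_S q r"
    and q_cosets: "coarsely_maps_into H.fin.dist_S q (left_cosets G \<P>) (left_cosets H \<Q>)"
    and r_cosets: "coarsely_maps_into G.fin.dist_S r (left_cosets H \<Q>) (left_cosets G \<P>)"
begin

lemma swap: "pair_equivalence H T0 T \<Q> G S0 S \<P> r q"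
  by unfold_locales
    (fact r_closed q_closed r_lipschitz_fin q_lipschitz_fin r_lipschitz q_lipschitz
       qr rq r_cosets q_cosets)+

text \<open>
  The map of coned-off Cayley graphs sends edges to bounded paths. Such a path meets cone vertices
  only among the images of the endpoints of the edge, whence the bound in the graph without \<open>W\<close>.
\<close>

lemma cone_map_edge:
  assumes F: "\<And>A. A \<in> left_cosets G \<P> \<Longrightarrow> F A \<in> left_cosets H \<Q> \<and> set_close H.fin.dist_S M (q ` A) (F A)"
  shows "\<exists>L. \<forall>u v W. (u, v) \<in> G.cone_edges \<longrightarrow> W \<subseteq> range Inr \<longrightarrow>
           map_sum q F u \<notin> W \<longrightarrow> map_sum q F v \<notin> W \<longrightarrow>
           graph_dist (avoid H.cone_edges W) (map_sum q F u) (map_sum q F v) \<le> enat L"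
proof -
  obtain K where K: "\<And>x y. x \<in> carrier G \<Longrightarrow> y \<in> carrier G \<Longrightarrow>
      H.dist_S (q x) (q y) \<le> K * G.dist_S x y + K"
    using q_lipschitz unfolding coarsely_lipschitz_def by blast
  obtain K' where K': "\<And>x y. x \<in> carrier H \<Longrightarrow> y \<in> carrier H \<Longrightarrow> H.dist_S x y \<le> K' * H.fin.dist_S x y"
    using H.fin.dist_le_other_word_dist[OF H.gen] by blast
  have cone_step: "graph_dist (avoid H.cone_edges W) (Inl (q x)) (Inr (F A)) \<le> enat (K' * M + 1)"
    if A: "A \<in> left_cosets G \<P>" "x \<in> A" and W: "W \<subseteq> range Inr" "Inr (F A) \<notin> W" for x A W
  proof -
    have x: "x \<in> carrier G" using G.coset_closed A by blast
    obtain b where b: "b \<in> F A" "H.fin.dist_S (q x) b \<le> M"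
      using F[OF A(1)] A(2) unfolding set_close_def by blast
    have bH: "b \<in> carrier H" using H.coset_closed F[OF A(1)] b(1) by blast
    have "H.dist_S (q x) b \<le> K' * H.fin.dist_S (q x) b" using K' q_closed[OF x] bH by blast
    also have "\<dots> \<le> K' * M" using b(2) by simp
    finally have "enat (H.dist_S (q x) b) \<le> enat (K' * M)" by simp
    then have 1: "graph_dist (avoid H.cone_edges W) (Inl (q x)) (Inl b) \<le> enat (K' * M)"
      using H.graph_dist_avoid_le[OF q_closed[OF x] bH W(1)] by (rule order_trans[rotated])
    have "(Inl b, Inr (F A)) \<in> H.cone_edges" using H.cone_edge F[OF A(1)] b(1) by blast
    then have "(Inl b, Inr (F A)) \<in> avoid H.cone_edges W" using W unfolding avoid_def by blast
    then show ?thesis using graph_dist_trans[OF 1 graph_dist_edge] by blast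
  qed
  have "graph_dist (avoid H.cone_edges W) (map_sum q F u) (map_sum q F v) \<le> enat (2 * K + (K' * M + 1))"
    if uv: "(u, v) \<in> G.cone_edges" and W: "W \<subseteq> range Inr" "map_sum q F u \<notin> W" "map_sum q F v \<notin> W"
    for u v W
    using uv
  proof (cases rule: G.cone_edge_cases)
    case (cayley x y)
    then have xy: "x \<in> carrier G" "y \<in> carrier G" using G.cayley.edges_verts by blast+
    have "H.dist_S (q x) (q y) \<le> K * G.dist_S x y + K" using K xy by blast
    also have "\<dots> \<le> K * 1 + K" using G.cayley.path_dist_edge[OF cayley(3)] by (intro add_mono mult_le_mono) auto
    finally have "enat (H.dist_S (q x) (q y)) \<le> enat (2 * K + (K' * M + 1))" by simp
    then show ?thesis
      using H.graph_dist_avoid_le[OF q_closed[OF xy(1)] q_closed[OF xy(2)] W(1)] cayley(1,2)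
      by (auto intro: order_trans)
  next
    case (to_cone x A)
    then have "graph_dist (avoid H.cone_edges W) (Inl (q x)) (Inr (F A)) \<le> enat (K' * M + 1)"
      using cone_step W by simp
    also have "enat (K' * M + 1) \<le> enat (2 * K + (K' * M + 1))" by simp
    finally show ?thesis using to_cone(1,2) by simp
  next
    case (from_cone x A)
    then have "graph_dist (avoid H.cone_edges W) (Inl (q x)) (Inr (F A)) \<le> enat (K' * M + 1)"
      using cone_step W by simp
    then have "graph_dist (avoid H.cone_edges W) (Inr (F A)) (Inl (q x)) \<le> enat (K' * M + 1)"
      by (rule graph_dist_sym[OF sym_avoid[OF H.cone_edges_sym]])
    also have "enat (K' * M + 1) \<le> enat (2 * K + (K' * M + 1))" by simp
    finally show ?thesis using from_cone(1,2) by simp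
  qed
  then show ?thesis by blast
qed

lemma cone_map_closed:
  assumes "\<And>A. A \<in> left_cosets G \<P> \<Longrightarrow> F A \<in> left_cosets H \<Q>" and "u \<in> G.cone_verts"
  shows "map_sum q F u \<in> H.cone_verts"
  using assms q_closed unfolding coned_off_verts_def by auto

lemma cone_map_lipschitz:
  assumes F: "\<And>A. A \<in> left_cosets G \<P> \<Longrightarrow> F A \<in> left_cosets H \<Q> \<and> set_close H.fin.dist_S M (q ` A) (F A)"
  shows "\<exists>L. \<forall>u\<in>G.cone_verts. \<forall>v\<in>G.cone_verts.
           path_dist H.cone_edges (map_sum q F u) (map_sum q F v) \<le> L * path_dist G.cone_edges u v"
proof -
  obtain L where L: "\<And>u v W. (u, v) \<in> G.cone_edges \<Longrightarrow> W \<subseteq> range Inr \<Longrightarrow>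
           map_sum q F u \<notin> W \<Longrightarrow> map_sum q F v \<notin> W \<Longrightarrow>
           graph_dist (avoid H.cone_edges W) (map_sum q F u) (map_sum q F v) \<le> enat L"
    using cone_map_edge[of F M] F by blast
  have "path_dist H.cone_edges (map_sum q F u) (map_sum q F v) \<le> L * path_dist G.cone_edges u v"
    if uv: "u \<in> G.cone_verts" "v \<in> G.cone_verts" for u v
  proof -
    have "graph_dist H.cone_edges (map_sum q F u) (map_sum q F v) \<le> enat (L * path_dist G.cone_edges u v)"
    proof (rule graph_dist_lipschitz[where f = "map_sum q F"])
      fix u v assume "(u, v) \<in> G.cone_edges"
      then show "graph_dist H.cone_edges (map_sum q F u) (map_sum q F v) \<le> enat L"
        using L[of u v "{}"] by simp
    qed (simp add: G.cone.graph_dist_eq uv)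
    then show ?thesis using cone_map_closed[of F] F uv by (simp add: H.cone.graph_dist_eq)
  qed
  then show ?thesis by blast
qed

lemma coset_map_exists:
  "\<exists>F M. \<forall>A\<in>left_cosets G \<P>. F A \<in> left_cosets H \<Q> \<and> set_close H.fin.dist_S M (q ` A) (F A)"
proof -
  obtain M where "\<forall>A\<in>left_cosets G \<P>. \<exists>B. B \<in> left_cosets H \<Q> \<and> set_close H.fin.dist_S M (q ` A) B"
    using q_cosets unfolding coarsely_maps_into_def by blast
  then show ?thesis by (meson bchoice)
qed

text \<open>
  The maps of coned-off Cayley graphs induced by \<open>q\<close> and \<open>r\<close> are Lipschitz. Their composition is close
  to the identity on the group, hence also on cone vertices, which are adjacent to group elements; so
  the first map is a quasi-isometric embedding.
\<close>

lemma slim_triangles_transfer: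
  assumes slim: "slim_triangles H.cone_verts (path_dist H.cone_edges) \<delta>"
  shows "\<exists>\<delta>'. slim_triangles G.cone_verts (path_dist G.cone_edges) \<delta>'"
proof -
  interpret swap: pair_equivalence H T0 T \<Q> G S0 S \<P> r q by (rule swap)
  obtain F M where F: "\<And>A. A \<in> left_cosets G \<P> \<Longrightarrow>
      F A \<in> left_cosets H \<Q> \<and> set_close H.fin.dist_S M (q ` A) (F A)"
    using coset_map_exists by blast
  obtain F' M' where F': "\<And>B. B \<in> left_cosets H \<Q> \<Longrightarrow>
      F' B \<in> left_cosets G \<P> \<and> set_close G.fin.dist_S M' (r ` B) (F' B)"
    using swap.coset_map_exists by blast
  let ?f = "map_sum q F" and ?g = "map_sum r F'"
  let ?d = "path_dist G.cone_edges" and ?d' = "path_dist H.cone_edges"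
  obtain L where L: "\<And>u v. u \<in> G.cone_verts \<Longrightarrow> v \<in> G.cone_verts \<Longrightarrow> ?d' (?f u) (?f v) \<le> L * ?d u v"
    using cone_map_lipschitz[of F M] F by blast
  obtain L' where L': "\<And>u v. u \<in> H.cone_verts \<Longrightarrow> v \<in> H.cone_verts \<Longrightarrow> ?d (?g u) (?g v) \<le> L' * ?d' u v"
    using swap.cone_map_lipschitz[of F' M'] F' by blast
  have f: "?f u \<in> H.cone_verts" if "u \<in> G.cone_verts" for u using cone_map_closed F that by blast
  have g: "?g u \<in> G.cone_verts" if "u \<in> H.cone_verts" for u using swap.cone_map_closed F' that by blast
  obtain K where K: "\<And>x. x \<in> carrier G \<Longrightarrow> G.fin.dist_S (r (q x)) x \<le> K"
    using rq unfolding coarse_inverse_def by blast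
  obtain N where N: "\<And>x y. x \<in> carrier G \<Longrightarrow> y \<in> carrier G \<Longrightarrow> G.dist_S x y \<le> N * G.fin.dist_S x y"
    using G.fin.dist_le_other_word_dist[OF G.gen] by blast
  have group: "?d (?g (?f (Inl x))) (Inl x) \<le> N * K" if x: "x \<in> carrier G" for x
  proof -
    have rqx: "r (q x) \<in> carrier G" using x q_closed r_closed by blast
    have "G.dist_S (r (q x)) x \<le> N * G.fin.dist_S (r (q x)) x" using N rqx x by blast
    also have "\<dots> \<le> N * K" using K[OF x] by simp
    finally have "enat (G.dist_S (r (q x)) x) \<le> enat (N * K)" by simp
    moreover have "graph_dist G.cone_edges (Inl (r (q x))) (Inl x) \<le> enat (G.dist_S (r (q x)) x)"
      using G.graph_dist_avoid_le[OF rqx x, of "{}"] by simp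
    ultimately have "graph_dist G.cone_edges (Inl (r (q x))) (Inl x) \<le> enat (N * K)"
      by (rule order_trans[rotated])
    moreover have "Inl (r (q x)) \<in> G.cone_verts" "Inl x \<in> G.cone_verts"
      using rqx x unfolding coned_off_verts_def by auto
    ultimately show ?thesis by (simp add: G.cone.graph_dist_eq)
  qed
  have inverse: "?d (?g (?f u)) u \<le> L' * L + N * K + 1" if u: "u \<in> G.cone_verts" for u
  proof (cases u)
    case (Inl x)
    then have "x \<in> carrier G" using u unfolding coned_off_verts_def by auto
    then show ?thesis using group[of x] Inl by simp
  next
    case (Inr A)
    then have A: "A \<in> left_cosets G \<P>" using u unfolding coned_off_verts_def by auto
    then obtain x where x: "x \<in> A" using G.coset_nonempty by blast
    then have xG: "x \<in> carrier G" using G.coset_closed A by blast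
    then have xV: "Inl x \<in> G.cone_verts" unfolding coned_off_verts_def by (rule InlI)
    have xu: "?d (Inl x) u \<le> 1" using G.cone.path_dist_edge[OF G.cone_edge[OF A x]] Inr by simp
    then have ux: "?d u (Inl x) \<le> 1" using G.cone.dist_sym[OF xV u] by simp
    have "?d (?g (?f u)) (?g (?f (Inl x))) \<le> L' * ?d' (?f u) (?f (Inl x))" using L' f u xV by blast
    also have "\<dots> \<le> L' * (L * ?d u (Inl x))" using L[OF u xV] by (rule mult_le_mono2)
    also have "\<dots> \<le> L' * (L * 1)" using ux by (intro mult_le_mono) auto
    finally have "?d (?g (?f u)) (?g (?f (Inl x))) \<le> L' * L" by simp
    moreover have "?d (?g (?f u)) (Inl x) \<le> ?d (?g (?f u)) (?g (?f (Inl x))) + ?d (?g (?f (Inl x))) (Inl x)"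
      using G.cone.dist_tri f g u xV by blast
    moreover have "?d (?g (?f u)) u \<le> ?d (?g (?f u)) (Inl x) + ?d (Inl x) u"
      using G.cone.dist_tri f g u xV by blast
    ultimately show ?thesis using group[OF xG] xu by linarith
  qed
  define C where "C = L' * L + N * K + 1"
  define B where "B = L + L' + 2 * C"
  show ?thesis
  proof (rule slim_triangles_quasi_isometric_embedding[OF _ _ slim, where f = ?f and K = B])
    show "geodesic_space G.cone_verts ?d" by (rule G.cone.geodesic_space_axioms)
    show "geodesic_space H.cone_verts ?d'" by (rule H.cone.geodesic_space_axioms)
    fix u assume u: "u \<in> G.cone_verts"
    show "?f u \<in> H.cone_verts" using f u .
    fix v assume v: "v \<in> G.cone_verts"
    have "?d' (?f u) (?f v) \<le> L * ?d u v" using L u v by blast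
    also have "\<dots> \<le> B * ?d u v" unfolding B_def by (intro mult_le_mono) auto
    finally show "?d' (?f u) (?f v) \<le> B * ?d u v" .
    have gf: "?g (?f u) \<in> G.cone_verts" "?g (?f v) \<in> G.cone_verts" using f g u v by blast+
    have "?d u v \<le> ?d u (?g (?f u)) + ?d (?g (?f u)) v" using G.cone.dist_tri u v gf by blast
    moreover have "?d (?g (?f u)) v \<le> ?d (?g (?f u)) (?g (?f v)) + ?d (?g (?f v)) v"
      using G.cone.dist_tri u v gf by blast
    moreover have "?d u (?g (?f u)) = ?d (?g (?f u)) u" using G.cone.dist_sym u gf by blast
    moreover have "?d (?g (?f u)) (?g (?f v)) \<le> L' * ?d' (?f u) (?f v)" using L' f u v by blast
    moreover have "L' * ?d' (?f u) (?f v) \<le> B * ?d' (?f u) (?f v)"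
      unfolding B_def by (intro mult_le_mono) auto
    moreover have "?d (?g (?f u)) u \<le> C" "?d (?g (?f v)) v \<le> C"
      using inverse u v unfolding C_def by blast+
    ultimately show "?d u v \<le> B * ?d' (?f u) (?f v) + B" unfolding B_def by linarith
  qed
qed

text \<open>
  A short path that joins \<open>x\<close> and \<open>a\<close> in \<open>A\<close> and misses the cone vertex of \<open>A\<close> is mapped to a short
  path that misses the cone vertex of \<open>F A\<close> and can be continued to points of \<open>F A\<close> close to \<open>q x\<close> and
  \<open>q a\<close>. Fineness at \<open>F A\<close> leaves finitely many possibilities for the latter point, hence for \<open>q a\<close> as
  balls are finite, hence for \<open>a\<close> as \<open>a\<close> is close to \<open>r (q a)\<close>.
\<close>

lemma fine_at_transfer:
  assumes F: "\<And>A. A \<in> left_cosets G \<P> \<Longrightarrow> F A \<in> left_cosets H \<Q> \<and> set_close H.fin.dist_S M (q ` A) (F A)"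
    and inj: "inj_on F (left_cosets G \<P>)"
    and A: "A \<in> left_cosets G \<P>" and fine: "fine_at H.cone_edges (Inr (F A))"
  shows "fine_at G.cone_edges (Inr A)"
  unfolding fine_at_def
proof (intro ballI allI)
  fix u and n :: nat assume "u \<in> graph_link G.cone_edges (Inr A)"
  then obtain x where x: "u = Inl x" "x \<in> A" using G.cone_link[OF A] by auto
  let ?EG = "avoid G.cone_edges {Inr A}" and ?EH = "avoid H.cone_edges {Inr (F A)}"
  obtain L where L: "\<And>u v W. (u, v) \<in> G.cone_edges \<Longrightarrow> W \<subseteq> range Inr \<Longrightarrow>
           map_sum q F u \<notin> W \<Longrightarrow> map_sum q F v \<notin> W \<Longrightarrow>
           graph_dist (avoid H.cone_edges W) (map_sum q F u) (map_sum q F v) \<le> enat L"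
    using cone_map_edge[of F M] F by blast
  obtain K where K: "\<And>x y. x \<in> carrier H \<Longrightarrow> y \<in> carrier H \<Longrightarrow> H.dist_S x y \<le> K * H.fin.dist_S x y"
    using H.fin.dist_le_other_word_dist[OF H.gen] by blast
  obtain N where N: "\<And>x. x \<in> carrier G \<Longrightarrow> G.fin.dist_S (r (q x)) x \<le> N"
    using rq unfolding coarse_inverse_def by blast
  have FA: "F A \<in> left_cosets H \<Q>" using F[OF A] by blast
  have AG: "A \<subseteq> carrier G" and FAH: "F A \<subseteq> carrier H" using G.coset_closed[OF A] H.coset_closed[OF FA] .
  \<comment> \<open>Injectivity keeps the image of a path that misses the cone vertex of \<open>A\<close> away from that of \<open>F A\<close>.\<close>
  have edge: "graph_dist ?EH (map_sum q F u) (map_sum q F v) \<le> enat L" if "(u, v) \<in> ?EG" for u v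
  proof (rule L)
    have uv: "(u, v) \<in> G.cone_edges" "u \<noteq> Inr A" "v \<noteq> Inr A" using that unfolding avoid_def by auto
    have "map_sum q F w \<noteq> Inr (F A)" if w: "w \<in> G.cone_verts" "w \<noteq> Inr A" for w
    proof (cases w)
      case (Inr A')
      then have "A' \<in> left_cosets G \<P>" "A' \<noteq> A" using w unfolding coned_off_verts_def by auto
      then show ?thesis using inj A Inr by (auto dest: inj_onD)
    qed simp
    then show "map_sum q F u \<notin> {Inr (F A)}" "map_sum q F v \<notin> {Inr (F A)}"
      using uv G.cone.edges_verts by blast+
    show "(u, v) \<in> G.cone_edges" by (rule uv(1))
  qed auto
  have "\<forall>a\<in>A. \<exists>b. b \<in> F A \<and> H.fin.dist_S (q a) b \<le> M" using F[OF A] unfolding set_close_def by blast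
  then obtain \<phi> where \<phi>: "\<And>a. a \<in> A \<Longrightarrow> \<phi> a \<in> F A \<and> H.fin.dist_S (q a) (\<phi> a) \<le> M" by (meson bchoice)
  have near: "graph_dist ?EH (Inl (q a)) (Inl (\<phi> a)) \<le> enat (K * M)" if a: "a \<in> A" for a
  proof -
    have mem: "q a \<in> carrier H" "\<phi> a \<in> carrier H" using q_closed a AG \<phi> FAH by blast+
    have "H.dist_S (q a) (\<phi> a) \<le> K * H.fin.dist_S (q a) (\<phi> a)" using K mem by blast
    also have "\<dots> \<le> K * M" using \<phi>[OF a] by simp
    finally have "enat (H.dist_S (q a) (\<phi> a)) \<le> enat (K * M)" by simp
    with H.graph_dist_avoid_le[OF mem] show ?thesis by (rule order_trans) auto
  qed
  have EH_sym: "sym ?EH" by (rule sym_avoid[OF H.cone_edges_sym])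
  let ?R = "K * M + (L * n + K * M)"
  let ?Z = "{b \<in> F A. graph_dist ?EH (Inl (\<phi> x)) (Inl b) \<le> enat ?R}"
  have "finite {v \<in> graph_link H.cone_edges (Inr (F A)).
          angle_dist H.cone_edges (Inr (F A)) (Inl (\<phi> x)) v \<le> enat ?R}"
    using fine \<phi>[OF x(2)] unfolding fine_at_def H.cone_link[OF FA] by blast
  then have "finite (Inl ` ?Z :: ('b + 'b set) set)"
    by (rule rev_finite_subset) (auto simp: angle_dist_eq H.cone_link[OF FA])
  then have finZ: "finite ?Z" by (rule finite_imageD) simp
  have finq: "finite (\<Union>b\<in>?Z. {y \<in> carrier H. H.fin.dist_S b y \<le> M})"
    using finZ H.fin.finite_ball FAH by blast
  let ?X = "\<Union>y\<in>(\<Union>b\<in>?Z. {y \<in> carrier H. H.fin.dist_S b y \<le> M}). {a \<in> carrier G. G.fin.dist_S (r y) a \<le> N}"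
  have finX: "finite ?X"
  proof (rule finite_UN_I[OF finq])
    fix y assume "y \<in> (\<Union>b\<in>?Z. {y \<in> carrier H. H.fin.dist_S b y \<le> M})"
    then have "r y \<in> carrier G" using r_closed by blast
    then show "finite {a \<in> carrier G. G.fin.dist_S (r y) a \<le> N}" by (rule G.fin.finite_ball)
  qed
  have "{v \<in> graph_link G.cone_edges (Inr A). angle_dist G.cone_edges (Inr A) u v \<le> enat n} \<subseteq> Inl ` ?X"
  proof
    fix v assume v: "v \<in> {v \<in> graph_link G.cone_edges (Inr A). angle_dist G.cone_edges (Inr A) u v \<le> enat n}"
    then obtain a where a: "v = Inl a" "a \<in> A" using G.cone_link[OF A] by auto
    have aG: "a \<in> carrier G" and qa: "q a \<in> carrier H" using a AG q_closed by blast+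
    have "graph_dist ?EG (Inl x) (Inl a) \<le> enat n" using v a x by (simp add: angle_dist_eq)
    then have "graph_dist ?EH (map_sum q F (Inl x)) (map_sum q F (Inl a)) \<le> enat (L * n)"
      by (rule graph_dist_lipschitz[rotated]) (rule edge)
    then have "graph_dist ?EH (Inl (q x)) (Inl (q a)) \<le> enat (L * n)" by simp
    then have "graph_dist ?EH (Inl (\<phi> x)) (Inl (\<phi> a)) \<le> enat ?R"
      by (intro graph_dist_trans[OF graph_dist_sym[OF EH_sym near[OF x(2)]]] graph_dist_trans[OF _ near[OF a(2)]])
    then have "\<phi> a \<in> ?Z" using \<phi>[OF a(2)] by blast
    moreover have "H.fin.dist_S (\<phi> a) (q a) \<le> M"
      using \<phi>[OF a(2)] H.fin.cayley.dist_sym[of "q a" "\<phi> a"] qa FAH by auto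
    ultimately have "a \<in> ?X" using N[OF aG] aG qa by blast
    then show "v \<in> Inl ` ?X" using a(1) by blast
  qed
  then show "finite {v \<in> graph_link G.cone_edges (Inr A). angle_dist G.cone_edges (Inr A) u v \<le> enat n}"
    using finX by (meson finite_imageI finite_subset)
qed

lemma set_close_if_images_close:
  "\<exists>D. \<forall>A A'. A \<subseteq> carrier G \<longrightarrow> A' \<subseteq> carrier G \<longrightarrow> set_close H.fin.dist_S n (q ` A) (q ` A') \<longrightarrow>
     set_close G.fin.dist_S D A A'"
proof -
  obtain K where K: "\<And>x y. x \<in> carrier H \<Longrightarrow> y \<in> carrier H \<Longrightarrow>
      G.fin.dist_S (r x) (r y) \<le> K * H.fin.dist_S x y + K"
    using r_lipschitz_fin unfolding coarsely_lipschitz_def by blast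
  obtain N where N: "\<And>x. x \<in> carrier G \<Longrightarrow> G.fin.dist_S (r (q x)) x \<le> N"
    using rq unfolding coarse_inverse_def by blast
  have "set_close G.fin.dist_S (N + (K * n + K) + N) A A'"
    if A: "A \<subseteq> carrier G" "A' \<subseteq> carrier G" and im: "set_close H.fin.dist_S n (q ` A) (q ` A')" for A A'
  proof -
    have qA: "q ` A \<subseteq> carrier H" "q ` A' \<subseteq> carrier H" using A q_closed by blast+
    then have rqA: "r ` q ` A \<subseteq> carrier G" "r ` q ` A' \<subseteq> carrier G" using r_closed by blast+
    have near_id: "set_close G.fin.dist_S N (r ` q ` X) X" if "X \<subseteq> carrier G" for X
      using set_close_inverse_image[of X G.fin.dist_S r q N] N that by blast
    have "set_close G.fin.dist_S (K * n + K) (r ` q ` A) (r ` q ` A')"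
      by (rule set_close_image[where X = "carrier H" and d = H.fin.dist_S]) (use K qA im in auto)
    then have "set_close G.fin.dist_S (N + (K * n + K)) A (r ` q ` A')"
      using G.fin.cayley.set_close_sym[OF rqA(1) A(1) near_id[OF A(1)]]
      by (intro G.fin.cayley.set_close_trans[OF A(1) rqA])
    then show ?thesis using near_id[OF A(2)] by (intro G.fin.cayley.set_close_trans[OF A(1) rqA(2) A(2)])
  qed
  then show ?thesis by blast
qed

text \<open>
  Separated cosets of \<open>\<P>\<close> correspond to different cosets of \<open>\<Q>\<close>, since \<open>r\<close> brings closeness back
  to \<open>G\<close>. So the map of cosets is injective, as the transfer of fineness requires.
\<close>

theorem hyperbolically_embedded_transfer:
  assumes separated: "G.separated_cosets" and hyp: "hyperbolically_embedded H \<Q> T"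
  shows "hyperbolically_embedded G \<P> S"
proof -
  obtain F M where F: "\<And>A. A \<in> left_cosets G \<P> \<Longrightarrow>
      F A \<in> left_cosets H \<Q> \<and> set_close H.fin.dist_S M (q ` A) (F A)"
    using coset_map_exists by blast
  have "inj_on F (left_cosets G \<P>)"
  proof (rule inj_onI)
    fix A A' assume A: "A \<in> left_cosets G \<P>" "A' \<in> left_cosets G \<P>" and eq: "F A = F A'"
    have sub: "q ` A \<subseteq> carrier H" "q ` A' \<subseteq> carrier H" "F A' \<subseteq> carrier H"
      using G.coset_closed A q_closed H.coset_closed F by blast+
    have "set_close H.fin.dist_S M (q ` A) (F A')" "set_close H.fin.dist_S M (q ` A') (F A')"
      using F A eq by metis+
    then have "set_close H.fin.dist_S (M + M) (q ` A) (q ` A')"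
      using H.fin.cayley.set_close_trans[OF sub(1,3,2)] H.fin.cayley.set_close_sym[OF sub(2,3)] by blast
    then obtain D where "set_close G.fin.dist_S D A A'"
      using set_close_if_images_close[of "M + M"] G.coset_closed A by blast
    then have "coarsely_equal (carrier G) G.fin.dist_S A A'"
      using coarsely_equalI G.coset_closed A by blast
    then show "A = A'" using G.separated_cosetsD[OF separated] A by blast
  qed
  then have "fine_at G.cone_edges (Inr A)" if "A \<in> left_cosets G \<P>" for A
    using fine_at_transfer[OF F _ that] F[OF that] hyp unfolding H.hyperbolically_embedded_iff by blast
  moreover obtain \<delta> where "slim_triangles H.cone_verts (path_dist H.cone_edges) \<delta>"
    using hyp unfolding H.hyperbolically_embedded_iff by blast
  ultimately show ?thesis
    unfolding G.hyperbolically_embedded_iff using slim_triangles_transfer by blast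
qed

end

section \<open>Refinements\<close>

text \<open>
  Makes distances uniform over the finitely many members of a collection and of its refinement.
\<close>

lemma uniform_set_close:
  assumes "finite I" and "\<And>i. i \<in> I \<Longrightarrow> \<exists>n. set_close d n (X i) (Y i)"
  shows "\<exists>n. \<forall>i\<in>I. set_close d n (X i) (Y i)"
proof -
  have "\<forall>i\<in>I. \<exists>n. set_close d n (X i) (Y i)" using assms(2) by blast
  then obtain n where n: "\<And>i. i \<in> I \<Longrightarrow> set_close d (n i) (X i) (Y i)" by (meson bchoice)
  have "n i \<le> Max (n ` I)" if "i \<in> I" for i using assms(1) that by simp
  then have "set_close d (Max (n ` I)) (X i) (Y i)" if "i \<in> I" for i
    using set_close_mono n that by blast
  then show ?thesis by blast
qed

lemma coarsely_maps_into_precompose: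
  assumes X: "geodesic_space X d" and Y: "geodesic_space Y d'"
    and f: "\<And>x. x \<in> X \<Longrightarrow> f x \<in> Y" "coarsely_lipschitz X d d' f"
    and sub: "\<And>A. A \<in> \<A>' \<Longrightarrow> A \<subseteq> X" "\<And>A. A \<in> \<A> \<Longrightarrow> A \<subseteq> X" "\<And>B. B \<in> \<B> \<Longrightarrow> B \<subseteq> Y"
    and near: "\<And>A'. A' \<in> \<A>' \<Longrightarrow> \<exists>A\<in>\<A>. set_close d n A' A"
    and maps: "coarsely_maps_into d' f \<A> \<B>"
  shows "coarsely_maps_into d' f \<A>' \<B>"
proof -
  interpret Y: geodesic_space Y d' by fact
  obtain K where K: "\<And>x y. x \<in> X \<Longrightarrow> y \<in> X \<Longrightarrow> d' (f x) (f y) \<le> K * d x y + K"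
    using f(2) unfolding coarsely_lipschitz_def by blast
  obtain M where M: "\<And>A. A \<in> \<A> \<Longrightarrow> \<exists>B\<in>\<B>. set_close d' M (f ` A) B"
    using maps unfolding coarsely_maps_into_def by blast
  have "\<exists>B\<in>\<B>. set_close d' ((K * n + K) + M) (f ` A') B" if A': "A' \<in> \<A>'" for A'
  proof -
    obtain A where A: "A \<in> \<A>" "set_close d n A' A" using near[OF A'] by blast
    obtain B where B: "B \<in> \<B>" "set_close d' M (f ` A) B" using M[OF A(1)] by blast
    have "set_close d' (K * n + K) (f ` A') (f ` A)"
      by (rule set_close_image[where X = X and d = d]) (use K sub A A' in auto)
    moreover have fA: "f ` A' \<subseteq> Y" "f ` A \<subseteq> Y" using f(1) sub A A' by blast+
    ultimately have "set_close d' ((K * n + K) + M) (f ` A') B"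
      using Y.set_close_trans[OF fA sub(3)[OF B(1)] _ B(2)] by blast
    then show ?thesis using B(1) by blast
  qed
  then show ?thesis unfolding coarsely_maps_into_def by blast
qed

lemma coarsely_maps_into_postcompose:
  assumes X: "geodesic_space X d"
    and sub: "\<And>B. B \<in> \<B> \<Longrightarrow> f ` B \<subseteq> X" "\<And>A. A \<in> \<A> \<Longrightarrow> A \<subseteq> X" "\<And>A. A \<in> \<A>' \<Longrightarrow> A \<subseteq> X"
    and near: "\<And>A. A \<in> \<A> \<Longrightarrow> \<exists>A'\<in>\<A>'. set_close d n A A'"
    and maps: "coarsely_maps_into d f \<B> \<A>"
  shows "coarsely_maps_into d f \<B> \<A>'"
proof -
  interpret X: geodesic_space X d by fact
  obtain M where M: "\<And>B. B \<in> \<B> \<Longrightarrow> \<exists>A\<in>\<A>. set_close d M (f ` B) A"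
    using maps unfolding coarsely_maps_into_def by blast
  have "\<exists>A'\<in>\<A>'. set_close d (M + n) (f ` B) A'" if B: "B \<in> \<B>" for B
  proof -
    obtain A where A: "A \<in> \<A>" "set_close d M (f ` B) A" using M[OF B] by blast
    obtain A' where A': "A' \<in> \<A>'" "set_close d n A A'" using near[OF A(1)] by blast
    have "set_close d (M + n) (f ` B) A'"
      by (rule X.set_close_trans[OF sub(1)[OF B] sub(2)[OF A(1)] sub(3)[OF A'(1)] A(2) A'(2)])
    then show ?thesis using A'(1) by blast
  qed
  then show ?thesis unfolding coarsely_maps_into_def by blast
qed

context pair_equivalence begin

text \<open>
  For \<open>h\<close> in the commensurator of \<open>x P x\<inverse>\<close> the cosets \<open>x P\<close> and \<open>h x P\<close> are at finite Hausdorff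
  distance, hence correspond to one and the same coset of \<open>\<Q>\<close>, because those are separated. Now both
  are close to that coset with constants that do not depend on \<open>h\<close>, so \<open>h\<close> is within a uniform distance
  of \<open>x P\<close>. (In particular the index of \<open>x P x\<inverse>\<close> in its commensurator is finite.)
\<close>

lemma commensurator_coarsely_equal:
  assumes sep: "H.separated_cosets" and P: "P \<in> \<P>" "subgroup P G" and x: "x \<in> carrier G"
  shows "coarsely_equal (carrier G) G.fin.dist_S (x <#\<^bsub>G\<^esub> P) (commensurator G (conjugate G x P))"
proof -
  let ?P = "conjugate G x P" and ?xP = "x <#\<^bsub>G\<^esub> P"
  let ?C = "commensurator G ?P" and ?d = "G.fin.dist_S"
  have sub: "P \<subseteq> carrier G" using subgroup.subset[OF P(2)] .
  have P': "subgroup ?P G" using G.subgroup_conjugate[OF x P(2)] .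
  have P'_sub: "?P \<subseteq> carrier G" using subgroup.subset[OF P'] .
  have C_sub: "?C \<subseteq> carrier G" using subgroup.subset[OF G.fin.subgroup_commensurator[OF P']] .
  have xP: "?xP \<in> left_cosets G \<P>" using P(1) x unfolding left_cosets_iff by blast
  have xP_sub: "?xP \<subseteq> carrier G" using G.coset_closed[OF xP] .
  have conj: "coarsely_equal (carrier G) ?d ?xP ?P" by (rule G.fin.coarsely_equal_conjugate[OF x sub])
  then obtain m where m: "set_close ?d m ?xP ?P" unfolding coarsely_equal_def by blast
  obtain F M where F: "\<And>A. A \<in> left_cosets G \<P> \<Longrightarrow>
      F A \<in> left_cosets H \<Q> \<and> set_close H.fin.dist_S M (q ` A) (F A)"
    using coset_map_exists by blast
  obtain D where D: "\<And>A A'. A \<subseteq> carrier G \<Longrightarrow> A' \<subseteq> carrier G \<Longrightarrow>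
      set_close H.fin.dist_S (M + M) (q ` A) (q ` A') \<Longrightarrow> set_close ?d D A A'"
    using set_close_if_images_close[of "M + M"] by blast
  \<comment> \<open>The constants \<open>m\<close> and \<open>D\<close> are fixed before \<open>h\<close>. The closeness of \<open>x P\<close> and \<open>h x P\<close> that comes from the
      commensurator depends on \<open>h\<close>; it serves only to show that both have the same image under \<open>F\<close>.\<close>
  have "\<exists>a\<in>?xP. ?d a h \<le> D + m" if h: "h \<in> ?C" for h
  proof -
    have hG: "h \<in> carrier G" and hP: "coarsely_equal (carrier G) ?d ?P (h <#\<^bsub>G\<^esub> ?P)"
      using h G.fin.mem_commensurator_iff[OF P'] by auto
    let ?hxP = "h <#\<^bsub>G\<^esub> ?xP"
    have hxP: "?hxP \<in> left_cosets G \<P>"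
      using G.left_coset_translate[OF xP hG] G.peripheral_closed by blast
    have hxP_sub: "?hxP \<subseteq> carrier G" using G.coset_closed[OF hxP] .
    note conj
    also note hP
    also have "coarsely_equal (carrier G) ?d (h <#\<^bsub>G\<^esub> ?P) ?hxP"
      by (rule G.fin.cayley.coarsely_equal_sym[OF G.fin.coarsely_equal_translate[OF hG conj]])
    finally obtain k where k: "set_close ?d k ?xP ?hxP" unfolding coarsely_equal_def by blast
    have q_sub: "q ` ?xP \<subseteq> carrier H" "q ` ?hxP \<subseteq> carrier H" using xP_sub hxP_sub q_closed by blast+
    have FH: "F ?xP \<subseteq> carrier H" "F ?hxP \<subseteq> carrier H" using F xP hxP H.coset_closed by blast+
    obtain K where "\<And>x y. x \<in> carrier G \<Longrightarrow> y \<in> carrier G \<Longrightarrow> H.fin.dist_S (q x) (q y) \<le> K * ?d x y + K"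
      using q_lipschitz_fin unfolding coarsely_lipschitz_def by blast
    then have "set_close H.fin.dist_S (K * k + K) (q ` ?xP) (q ` ?hxP)"
      by (rule set_close_image[where X = "carrier G" and d = ?d]) (use xP_sub hxP_sub k in auto)
    then have images: "coarsely_equal (carrier H) H.fin.dist_S (q ` ?xP) (q ` ?hxP)"
      by (rule coarsely_equalI[OF q_sub])
    have F1: "coarsely_equal (carrier H) H.fin.dist_S (q ` ?xP) (F ?xP)"
      using F[OF xP] coarsely_equalI[OF q_sub(1) FH(1)] by blast
    have F2: "coarsely_equal (carrier H) H.fin.dist_S (q ` ?hxP) (F ?hxP)"
      using F[OF hxP] coarsely_equalI[OF q_sub(2) FH(2)] by blast
    note H.fin.cayley.coarsely_equal_sym[OF F1]
    also note images
    also note F2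
    finally have same: "F ?xP = F ?hxP"
      using H.separated_cosetsD[OF sep] F[OF xP] F[OF hxP] by blast
    have "set_close H.fin.dist_S (M + M) (q ` ?xP) (q ` ?hxP)"
      using H.fin.cayley.set_close_trans[OF q_sub(1) FH(1) q_sub(2)] F[OF xP]
        H.fin.cayley.set_close_sym[OF q_sub(2) FH(2)] F[OF hxP] same by simp
    then have close: "set_close ?d D ?xP ?hxP" by (rule D[OF xP_sub hxP_sub])
    have "h \<in> h <#\<^bsub>G\<^esub> ?P" using G.lcos_self[OF hG P'] .
    moreover have "set_close ?d m ?hxP (h <#\<^bsub>G\<^esub> ?P)"
      by (rule G.fin.set_close_translate[OF hG xP_sub P'_sub m])
    ultimately obtain a where a: "a \<in> ?hxP" "?d a h \<le> m" unfolding set_close_def by blast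
    obtain b where b: "b \<in> ?xP" "?d b a \<le> D" using close a(1) unfolding set_close_def by blast
    have "?d b h \<le> ?d b a + ?d a h"
      using G.fin.cayley.dist_tri[of b a h] a(1) b(1) xP_sub hxP_sub hG by blast
    then show ?thesis using a b by (intro bexI[of _ b]) auto
  qed
  moreover have "\<exists>h\<in>?C. ?d a h \<le> D + m" if a: "a \<in> ?xP" for a
  proof -
    obtain p where "p \<in> ?P" "?d a p \<le> m" using m a unfolding set_close_def by blast
    then show ?thesis using G.fin.subgroup_le_commensurator[OF P'] by (intro bexI[of _ p]) auto
  qed
  ultimately have "set_close ?d (D + m) ?xP ?C" unfolding set_close_def by blast
  then show ?thesis by (rule coarsely_equalI[OF xP_sub C_sub])
qed

text \<open>
  Each member \<open>R\<close> of the refinement is close to a coset \<open>x P\<close>, and each \<open>P \<in> \<P>\<close> is close to a coset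
  \<open>y R\<close>; left translation makes this uniform over all cosets, and the correspondence with cosets of
  \<open>\<Q>\<close> carries over. Separation: if \<open>R\<close> and \<open>h R'\<close> are close, then \<open>R\<close> and \<open>h R' h\<inverse>\<close> are commensurators
  of commensurable subgroups, hence equal; so \<open>R = R'\<close>, as both represent one conjugacy class, and \<open>h\<close>
  commensurates the subgroup whose commensurator is \<open>R\<close>, that is \<open>h \<in> R\<close>.
\<close>

lemma refinement_equivalence:
  assumes sep: "H.separated_cosets" and finite: "finite \<P>" and subgroups: "\<And>P. P \<in> \<P> \<Longrightarrow> subgroup P G"
    and ref: "is_refinement G \<P> \<R>"
  shows "pair_equivalence G S0 S \<R> H T0 T \<Q> q r" and "group_pair.separated_cosets G S0 \<R>"
proof -
  let ?d = "G.fin.dist_S"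
  define \<C> where "\<C> = {commensurator G (conjugate G g P) |g P. g \<in> carrier G \<and> P \<in> \<P>}"
  have ref': "\<R> \<subseteq> \<C>" "\<forall>K\<in>\<C>. \<exists>!R. R \<in> \<R> \<and> (\<exists>g\<in>carrier G. K = conjugate G g R)"
    using ref unfolding is_refinement_def Let_def \<C>_def[symmetric] by (rule conjunct1, rule conjunct2)
  have R_in: "R \<in> \<C>" if "R \<in> \<R>" for R using ref'(1) that by blast
  have R_cover: "\<exists>R\<in>\<R>. \<exists>g\<in>carrier G. K = conjugate G g R" if "K \<in> \<C>" for K
    using ex1_implies_ex[OF bspec[OF ref'(2) that]] by blast
  have R_unique: "R = R'" if "K \<in> \<C>" "R \<in> \<R>" "R' \<in> \<R>" "\<exists>g\<in>carrier G. K = conjugate G g R"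
      "\<exists>g\<in>carrier G. K = conjugate G g R'" for K R R'
    using ref'(2)[unfolded Ex1_def] that by metis
  have "\<forall>R\<in>\<R>. \<exists>xP. fst xP \<in> carrier G \<and> snd xP \<in> \<P> \<and> R = commensurator G (conjugate G (fst xP) (snd xP))"
    using R_in unfolding \<C>_def by fastforce
  then obtain xP where xP: "\<And>R. R \<in> \<R> \<Longrightarrow> fst (xP R) \<in> carrier G \<and> snd (xP R) \<in> \<P> \<and>
      R = commensurator G (conjugate G (fst (xP R)) (snd (xP R)))" by (meson bchoice)
  define x where "x R = fst (xP R)" for R
  define P where "P R = snd (xP R)" for R
  define P1 where "P1 R = conjugate G (x R) (P R)" for R
  have x: "x R \<in> carrier G" and P: "P R \<in> \<P>" and R_eq: "R = commensurator G (P1 R)" if "R \<in> \<R>" for R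
    using xP[OF that] unfolding x_def P_def P1_def by auto
  have P1: "subgroup (P1 R) G" if "R \<in> \<R>" for R
    unfolding P1_def using G.subgroup_conjugate x P subgroups that by blast
  have R_sub: "subgroup R G" if "R \<in> \<R>" for R
    using G.fin.subgroup_commensurator[OF P1[OF that]] R_eq[OF that] by simp
  have xP_R: "coarsely_equal (carrier G) ?d (x R <#\<^bsub>G\<^esub> P R) R" if "R \<in> \<R>" for R
    using commensurator_coarsely_equal[OF sep P[OF that] subgroups[OF P[OF that]] x[OF that]] R_eq[OF that]
    unfolding P1_def by simp
  have P1_R: "coarsely_equal (carrier G) ?d (P1 R) R" if "R \<in> \<R>" for R
  proof -
    have "coarsely_equal (carrier G) ?d (x R <#\<^bsub>G\<^esub> P R) (P1 R)" unfolding P1_def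
      by (rule G.fin.coarsely_equal_conjugate[OF x[OF that] subgroup.subset[OF subgroups[OF P[OF that]]]])
    then show ?thesis
      using xP_R[OF that] G.fin.cayley.coarsely_equal_trans G.fin.cayley.coarsely_equal_sym by blast
  qed
  have rigid: "R = R' \<and> h \<in> R" if R: "R \<in> \<R>" "R' \<in> \<R>" and h: "h \<in> carrier G"
    and close: "coarsely_equal (carrier G) ?d R (h <#\<^bsub>G\<^esub> R')" for R R' h
  proof -
    have P1': "coarsely_equal (carrier G) ?d (h <#\<^bsub>G\<^esub> R') (h <#\<^bsub>G\<^esub> P1 R')"
      by (rule G.fin.coarsely_equal_translate[OF h G.fin.cayley.coarsely_equal_sym[OF P1_R[OF R(2)]]])
    note P1_R[OF R(1)]
    also note close
    also note P1'
    finally have trans: "coarsely_equal (carrier G) ?d (P1 R) (h <#\<^bsub>G\<^esub> P1 R')" .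
    also have "coarsely_equal (carrier G) ?d (h <#\<^bsub>G\<^esub> P1 R') (conjugate G h (P1 R'))"
      by (rule G.fin.coarsely_equal_conjugate[OF h subgroup.subset[OF P1[OF R(2)]]])
    finally have "commensurator G (P1 R) = commensurator G (conjugate G h (P1 R'))"
      by (rule G.fin.commensurator_cong[OF P1[OF R(1)] G.subgroup_conjugate[OF h P1[OF R(2)]]])
    also have "\<dots> = conjugate G h (commensurator G (P1 R'))"
      by (rule G.fin.commensurator_conjugate[OF P1[OF R(2)] h])
    finally have "R = conjugate G h R'" using R_eq[OF R(1)] R_eq[OF R(2)] by simp
    moreover have "R = conjugate G \<one>\<^bsub>G\<^esub> R"
      using G.conjugate_one[OF subgroup.subset[OF R_sub[OF R(1)]]] by simp
    ultimately have eq: "R = R'" using R_unique[OF R_in[OF R(1)] R] h G.one_closed by blast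
    then have "h \<in> commensurator G (P1 R)"
      using trans h G.fin.mem_commensurator_iff[OF P1[OF R(1)]] by simp
    then show ?thesis using eq R_eq[OF R(1)] by simp
  qed
  have pair: "group_pair G S0 S \<R>"
    using R_sub subgroup.subset subgroup.one_closed by unfold_locales blast+
  interpret R: group_pair G S0 S \<R> by (rule pair)
  show "group_pair.separated_cosets G S0 \<R>"
    using rigid R_sub by (intro R.separated_cosetsI) auto
  have "inj_on P \<R>"
  proof (rule inj_onI)
    fix R R' assume R: "R \<in> \<R>" "R' \<in> \<R>" and eq: "P R = P R'"
    let ?h = "x R \<otimes>\<^bsub>G\<^esub> inv\<^bsub>G\<^esub> x R'"
    have h: "?h \<in> carrier G" using x R by simp
    have "coarsely_equal (carrier G) ?d (?h <#\<^bsub>G\<^esub> (x R' <#\<^bsub>G\<^esub> P R')) (?h <#\<^bsub>G\<^esub> R')"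
      by (rule G.fin.coarsely_equal_translate[OF h xP_R[OF R(2)]])
    moreover have "?h <#\<^bsub>G\<^esub> (x R' <#\<^bsub>G\<^esub> P R') = x R <#\<^bsub>G\<^esub> P R"
      using eq x[OF R(1)] x[OF R(2)] subgroup.subset[OF subgroups[OF P[OF R(2)]]]
      by (simp add: G.lcos_m_assoc G.m_assoc)
    ultimately have "coarsely_equal (carrier G) ?d R (?h <#\<^bsub>G\<^esub> R')"
      using xP_R[OF R(1)] G.fin.cayley.coarsely_equal_trans G.fin.cayley.coarsely_equal_sym by metis
    then show "R = R'" using rigid[OF R h] by blast
  qed
  then have "finite \<R>" using finite P by (auto intro: inj_on_finite)
  then obtain n where n: "\<And>R. R \<in> \<R> \<Longrightarrow> set_close ?d n R (x R <#\<^bsub>G\<^esub> P R)"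
    using uniform_set_close[of \<R> ?d "\<lambda>R. R" "\<lambda>R. x R <#\<^bsub>G\<^esub> P R"]
      G.fin.cayley.coarsely_equal_sym[OF xP_R] unfolding coarsely_equal_def by blast
  have near: "\<exists>A\<in>left_cosets G \<P>. set_close ?d n A' A" if "A' \<in> left_cosets G \<R>" for A'
  proof -
    obtain R g where R: "R \<in> \<R>" "g \<in> carrier G" "A' = g <#\<^bsub>G\<^esub> R"
      using \<open>A' \<in> left_cosets G \<R>\<close> unfolding left_cosets_iff by blast
    have "x R <#\<^bsub>G\<^esub> P R \<in> left_cosets G \<P>" using x P R(1) unfolding left_cosets_iff by blast
    then have "g <#\<^bsub>G\<^esub> (x R <#\<^bsub>G\<^esub> P R) \<in> left_cosets G \<P>"
      using G.left_coset_translate R(2) G.peripheral_closed by blast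
    moreover have "set_close ?d n (g <#\<^bsub>G\<^esub> R) (g <#\<^bsub>G\<^esub> (x R <#\<^bsub>G\<^esub> P R))"
      using G.fin.set_close_translate[OF R(2) _ _ n[OF R(1)]] coarsely_equal_closed[OF xP_R[OF R(1)]] by blast
    ultimately show ?thesis using R(3) by blast
  qed
  have "\<forall>Q\<in>\<P>. \<exists>yR. snd yR \<in> \<R> \<and> fst yR \<in> carrier G \<and> coarsely_equal (carrier G) ?d Q (fst yR <#\<^bsub>G\<^esub> snd yR)"
  proof
    fix Q assume Q: "Q \<in> \<P>"
    have Q_sub: "Q \<subseteq> carrier G" using subgroup.subset[OF subgroups[OF Q]] .
    let ?C = "commensurator G (conjugate G \<one>\<^bsub>G\<^esub> Q)"
    have "?C \<in> \<C>" unfolding \<C>_def using Q by blast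
    then obtain R y where R: "R \<in> \<R>" "y \<in> carrier G" "?C = conjugate G y R" using R_cover by blast
    have "coarsely_equal (carrier G) ?d (\<one>\<^bsub>G\<^esub> <#\<^bsub>G\<^esub> Q) ?C"
      by (rule commensurator_coarsely_equal[OF sep Q subgroups[OF Q] G.one_closed])
    then have "coarsely_equal (carrier G) ?d Q (conjugate G y R)"
      using G.lcos_mult_one[OF Q_sub] R(3) by simp
    also have "coarsely_equal (carrier G) ?d (conjugate G y R) (y <#\<^bsub>G\<^esub> R)"
      by (rule G.fin.cayley.coarsely_equal_sym[OF G.fin.coarsely_equal_conjugate[OF R(2)]])
        (rule subgroup.subset[OF R_sub[OF R(1)]])
    finally show "\<exists>yR. snd yR \<in> \<R> \<and> fst yR \<in> carrier G \<and> coarsely_equal (carrier G) ?d Q (fst yR <#\<^bsub>G\<^esub> snd yR)"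
      using R by (intro exI[of _ "(y, R)"]) simp
  qed
  then obtain yR where yR: "\<And>Q. Q \<in> \<P> \<Longrightarrow> snd (yR Q) \<in> \<R> \<and> fst (yR Q) \<in> carrier G \<and>
      coarsely_equal (carrier G) ?d Q (fst (yR Q) <#\<^bsub>G\<^esub> snd (yR Q))" by (meson bchoice)
  then obtain n' where n': "\<And>Q. Q \<in> \<P> \<Longrightarrow> set_close ?d n' Q (fst (yR Q) <#\<^bsub>G\<^esub> snd (yR Q))"
    using uniform_set_close[of \<P> ?d "\<lambda>Q. Q" "\<lambda>Q. fst (yR Q) <#\<^bsub>G\<^esub> snd (yR Q)"] finite
    unfolding coarsely_equal_def by blast
  have near': "\<exists>A'\<in>left_cosets G \<R>. set_close ?d n' A A'" if "A \<in> left_cosets G \<P>" for A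
  proof -
    obtain Q g where Q: "Q \<in> \<P>" "g \<in> carrier G" "A = g <#\<^bsub>G\<^esub> Q"
      using \<open>A \<in> left_cosets G \<P>\<close> unfolding left_cosets_iff by blast
    have "fst (yR Q) <#\<^bsub>G\<^esub> snd (yR Q) \<in> left_cosets G \<R>" using yR[OF Q(1)] unfolding left_cosets_iff by blast
    then have "g <#\<^bsub>G\<^esub> (fst (yR Q) <#\<^bsub>G\<^esub> snd (yR Q)) \<in> left_cosets G \<R>"
      using G.left_coset_translate Q(2) R.peripheral_closed by blast
    moreover have "set_close ?d n' (g <#\<^bsub>G\<^esub> Q) (g <#\<^bsub>G\<^esub> (fst (yR Q) <#\<^bsub>G\<^esub> snd (yR Q)))"
      using G.fin.set_close_translate[OF Q(2) _ _ n'[OF Q(1)]] coarsely_equal_closed yR[OF Q(1)] by blast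
    ultimately show ?thesis using Q(3) by blast
  qed
  have "coarsely_maps_into H.fin.dist_S q (left_cosets G \<R>) (left_cosets H \<Q>)"
    by (rule coarsely_maps_into_precompose[OF G.fin.cayley.geodesic_space_axioms
          H.fin.cayley.geodesic_space_axioms q_closed q_lipschitz_fin
          R.coset_closed G.coset_closed H.coset_closed near q_cosets])
  moreover have "coarsely_maps_into ?d r (left_cosets H \<Q>) (left_cosets G \<R>)"
    by (rule coarsely_maps_into_postcompose[OF G.fin.cayley.geodesic_space_axioms _
          G.coset_closed R.coset_closed near' r_cosets])
      (use H.coset_closed r_closed in blast)+
  ultimately show "pair_equivalence G S0 S \<R> H T0 T \<Q> q r"
    using q_closed r_closed q_lipschitz_fin r_lipschitz_fin q_lipschitz r_lipschitz rq qr
    by unfold_locales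
qed

end

section \<open>Quasi-isometries of pairs\<close>

lemma quasi_isometry_path_dist:
  assumes X: "connected_graph X E" and Y: "connected_graph Y E'"
    and q: "quasi_isometry X (graph_dist E) Y (graph_dist E') q"
  shows "\<exists>K. (\<forall>x\<in>X. q x \<in> Y) \<and>
    (\<forall>x\<in>X. \<forall>x'\<in>X. path_dist E' (q x) (q x') \<le> K * path_dist E x x' + K) \<and>
    (\<forall>x\<in>X. \<forall>x'\<in>X. path_dist E x x' \<le> K * path_dist E' (q x) (q x') + K) \<and>
    (\<forall>y\<in>Y. \<exists>x\<in>X. path_dist E' (q x) y \<le> K)"
proof -
  interpret X: connected_graph X E by fact
  interpret Y: connected_graph Y E' by fact
  obtain L C :: real where LC: "L \<ge> 1" "C \<ge> 0" and q_in: "q \<in> X \<rightarrow> Y"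
    and both: "\<And>x x'. x \<in> X \<Longrightarrow> x' \<in> X \<Longrightarrow>
        ereal (1 / L) * ereal_of_enat (graph_dist E x x') - ereal C \<le> ereal_of_enat (graph_dist E' (q x) (q x')) \<and>
        ereal_of_enat (graph_dist E' (q x) (q x')) \<le> ereal L * ereal_of_enat (graph_dist E x x') + ereal C"
    and dense: "\<And>y. y \<in> Y \<Longrightarrow> \<exists>x\<in>X. ereal_of_enat (graph_dist E' (q x) y) \<le> ereal C"
    using q unfolding quasi_isometry_def quasi_isometry_const_def by blast
  have qY: "q x \<in> Y" if "x \<in> X" for x using q_in that by blast
  \<comment> \<open>Solving the lower bound for the distance in \<open>X\<close> multiplies \<open>C\<close> by \<open>L\<close>.\<close>
  define K where "K = nat \<lceil>L + C + L * C\<rceil>"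
  have LC0: "0 \<le> L * C" using LC by simp
  have K: "L + C + L * C \<le> real K" unfolding K_def by linarith
  have K': "L \<le> real K" "C \<le> real K" "L * C \<le> real K" using K LC LC0 by linarith+
  have "path_dist E' (q x) (q x') \<le> K * path_dist E x x' + K \<and>
        path_dist E x x' \<le> K * path_dist E' (q x) (q x') + K" if x: "x \<in> X" "x' \<in> X" for x x'
  proof -
    let ?a = "real (path_dist E x x')" and ?b = "real (path_dist E' (q x) (q x'))"
    have low: "?a / L - C \<le> ?b" and up: "?b \<le> L * ?a + C"
      using both[OF x] x qY by (simp_all add: X.graph_dist_eq Y.graph_dist_eq)
    have "L * ?a \<le> real K * ?a" using K'(1) by (intro mult_right_mono) auto
    then have "?b \<le> real K * ?a + real K" using up K'(2) by linarith
    then have 1: "real (path_dist E' (q x) (q x')) \<le> real (K * path_dist E x x' + K)" by simp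
    have "?a / L \<le> ?b + C" using low by linarith
    then have "?a \<le> (?b + C) * L" using LC(1) by (simp add: pos_divide_le_eq)
    also have "\<dots> = L * ?b + L * C" by (simp add: algebra_simps)
    also have "\<dots> \<le> real K * ?b + real K" using K' by (intro add_mono mult_right_mono) auto
    finally have "real (path_dist E x x') \<le> real (K * path_dist E' (q x) (q x') + K)" by simp
    then show ?thesis using 1 unfolding of_nat_le_iff by blast
  qed
  moreover have "\<exists>x\<in>X. path_dist E' (q x) y \<le> K" if y: "y \<in> Y" for y
  proof -
    obtain x where x: "x \<in> X" "ereal_of_enat (graph_dist E' (q x) y) \<le> ereal C" using dense[OF y] by blast
    then have "real (path_dist E' (q x) y) \<le> C" using y qY by (simp add: Y.graph_dist_eq)
    then have "real (path_dist E' (q x) y) \<le> real K" using K'(2) by linarith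
    then show ?thesis using x(1) by auto
  qed
  ultimately show ?thesis using qY by blast
qed

lemma set_close_if_hausdorff_dist:
  assumes V: "connected_graph V E" and sub: "A \<subseteq> V" "B \<subseteq> V"
    and haus: "ereal_of_enat (hausdorff_dist (graph_dist E) A B) < ereal M"
  shows "set_close (path_dist E) (nat \<lceil>M\<rceil>) A B"
proof -
  interpret connected_graph V E by fact
  let ?n = "nat \<lceil>M\<rceil>"
  have "hausdorff_dist (graph_dist E) A B \<le> enat ?n"
  proof (cases "hausdorff_dist (graph_dist E) A B")
    case (enat k)
    then have "real k < M" using haus by simp
    then have "k \<le> ?n" by linarith
    then show ?thesis using enat by simp
  qed (use haus in simp)
  then have le: "(SUP a\<in>A. INF b\<in>B. graph_dist E a b) \<le> enat ?n"
      "(SUP b\<in>B. INF a\<in>A. graph_dist E a b) \<le> enat ?n"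
    unfolding hausdorff_dist_def by simp_all
  have "\<exists>b\<in>B. path_dist E a b \<le> ?n" if a: "a \<in> A" for a
  proof -
    have "(INF b\<in>B. graph_dist E a b) \<le> enat ?n" using le(1) a by (meson SUP_le_iff)
    then obtain b where "b \<in> B" "graph_dist E a b \<le> enat ?n" using INF_enat_le_attained by blast
    then show ?thesis using path_dist_le_iff[of a b ?n] sub a by blast
  qed
  moreover have "\<exists>a\<in>A. path_dist E a b \<le> ?n" if b: "b \<in> B" for b
  proof -
    have "(INF a\<in>A. graph_dist E a b) \<le> enat ?n" using le(2) b by (meson SUP_le_iff)
    then obtain a where "a \<in> A" "graph_dist E a b \<le> enat ?n"
      using INF_enat_le_attained[of "\<lambda>a. graph_dist E a b"] by blast
    then show ?thesis using path_dist_le_iff[of a b ?n] sub b by blast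
  qed
  ultimately show ?thesis unfolding set_close_def by blast
qed

lemma coarsely_lipschitz_section:
  assumes Y: "geodesic_space Y d'"
    and f: "\<And>x. x \<in> X \<Longrightarrow> f x \<in> Y" and g: "\<And>y. y \<in> Y \<Longrightarrow> g y \<in> X"
    and low: "\<And>x x'. x \<in> X \<Longrightarrow> x' \<in> X \<Longrightarrow> d x x' \<le> K * d' (f x) (f x') + K"
    and near: "\<And>y. y \<in> Y \<Longrightarrow> d' (f (g y)) y \<le> c"
  shows "coarsely_lipschitz Y d' d g"
proof -
  interpret Y: geodesic_space Y d' by fact
  have "d (g y) (g y') \<le> (K * (2 * c) + K) * d' y y' + (K * (2 * c) + K)" if y: "y \<in> Y" "y' \<in> Y" for y y'
  proof -
    have fg: "f (g y) \<in> Y" "f (g y') \<in> Y" using f g y by blast+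
    have "d' (f (g y)) (f (g y')) \<le> d' (f (g y)) y + d' y (f (g y'))" using Y.dist_tri fg y by blast
    moreover have "d' y (f (g y')) \<le> d' y y' + d' y' (f (g y'))" using Y.dist_tri fg y by blast
    moreover have "d' y' (f (g y')) = d' (f (g y')) y'" using Y.dist_sym fg y by blast
    ultimately have "d' (f (g y)) (f (g y')) \<le> d' y y' + 2 * c" using near[OF y(1)] near[OF y(2)] by linarith
    then have "K * d' (f (g y)) (f (g y')) \<le> K * (d' y y' + 2 * c)" by (rule mult_le_mono2)
    then have "d (g y) (g y') \<le> K * (d' y y' + 2 * c) + K"
      using low[OF g[OF y(1)] g[OF y(2)]] by linarith
    also have "\<dots> \<le> (K * (2 * c) + K) * d' y y' + (K * (2 * c) + K)" by (simp add: algebra_simps)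
    finally show ?thesis .
  qed
  then show ?thesis unfolding coarsely_lipschitz_def by blast
qed

text \<open>
  One quasi-inverse serves both pairs of metrics. Choose \<open>r y\<close> with \<open>q (r y)\<close> close to \<open>y\<close> for the finite
  generating set; then they are also close for \<open>T\<close>, and in both cases the lower bound of the
  quasi-isometry makes \<open>r\<close> coarsely Lipschitz.
\<close>

lemma pair_equivalence_if_qi_of_pairs:
  assumes G: "group_pair G S0 S \<P>" and H: "group_pair H T0 T \<Q>"
    and pairs: "qi_of_pairs G S0 \<P> H T0 \<Q> q"
    and qi: "quasi_isometry (carrier G) (word_dist G S) (carrier H) (word_dist H T) q"
  shows "\<exists>r. pair_equivalence G S0 S \<P> H T0 T \<Q> q r"
proof -
  interpret G: group_pair G S0 S \<P> by fact
  interpret H: group_pair H T0 T \<Q> by fact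
  obtain L C M where const: "qi_of_pairs_const L C M G S0 \<P> H T0 \<Q> q"
    using pairs unfolding qi_of_pairs_def by blast
  then have qi_fin: "quasi_isometry (carrier G) (word_dist G S0) (carrier H) (word_dist H T0) q"
    unfolding qi_of_pairs_const_def quasi_isometry_def by blast
  obtain K0 where q: "\<And>x. x \<in> carrier G \<Longrightarrow> q x \<in> carrier H"
    and up0: "\<And>x x'. x \<in> carrier G \<Longrightarrow> x' \<in> carrier G \<Longrightarrow>
      H.fin.dist_S (q x) (q x') \<le> K0 * G.fin.dist_S x x' + K0"
    and low0: "\<And>x x'. x \<in> carrier G \<Longrightarrow> x' \<in> carrier G \<Longrightarrow>
      G.fin.dist_S x x' \<le> K0 * H.fin.dist_S (q x) (q x') + K0"
    and dense0: "\<And>y. y \<in> carrier H \<Longrightarrow> \<exists>x\<in>carrier G. H.fin.dist_S (q x) y \<le> K0"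
    using quasi_isometry_path_dist[OF G.fin.cayley.connected_graph_axioms
        H.fin.cayley.connected_graph_axioms qi_fin[unfolded word_dist_def]] by metis
  obtain K1 where up: "\<And>x x'. x \<in> carrier G \<Longrightarrow> x' \<in> carrier G \<Longrightarrow>
      H.dist_S (q x) (q x') \<le> K1 * G.dist_S x x' + K1"
    and low: "\<And>x x'. x \<in> carrier G \<Longrightarrow> x' \<in> carrier G \<Longrightarrow>
      G.dist_S x x' \<le> K1 * H.dist_S (q x) (q x') + K1"
    using quasi_isometry_path_dist[OF G.cayley.connected_graph_axioms
        H.cayley.connected_graph_axioms qi[unfolded word_dist_def]] by metis
  have "\<forall>y\<in>carrier H. \<exists>x. x \<in> carrier G \<and> H.fin.dist_S (q x) y \<le> K0" using dense0 by blast
  then obtain r where r: "\<And>y. y \<in> carrier H \<Longrightarrow> r y \<in> carrier G"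
    and qr: "\<And>y. y \<in> carrier H \<Longrightarrow> H.fin.dist_S (q (r y)) y \<le> K0" using bchoice[of "carrier H"] by metis
  obtain N where N: "\<And>x y. x \<in> carrier H \<Longrightarrow> y \<in> carrier H \<Longrightarrow> H.dist_S x y \<le> N * H.fin.dist_S x y"
    using H.fin.dist_le_other_word_dist[OF H.gen] by blast
  have qr': "H.dist_S (q (r y)) y \<le> N * K0" if y: "y \<in> carrier H" for y
  proof -
    have "H.dist_S (q (r y)) y \<le> N * H.fin.dist_S (q (r y)) y" using N q r y by blast
    also have "\<dots> \<le> N * K0" using qr[OF y] by (rule mult_le_mono2)
    finally show ?thesis .
  qed
  \<comment> \<open>The quasi-inverse moves a point \<open>b\<close> back to within bounded distance of each \<open>a\<close> with \<open>q a\<close> near \<open>b\<close>.\<close>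
  have back_near: "G.fin.dist_S (r b) a \<le> K0 * (K0 + n) + K0"
    if "a \<in> carrier G" "b \<in> carrier H" "H.fin.dist_S (q a) b \<le> n" for a b n
  proof -
    have mem: "q a \<in> carrier H" "q (r b) \<in> carrier H" using q r that by blast+
    have "H.fin.dist_S (q (r b)) (q a) \<le> H.fin.dist_S (q (r b)) b + H.fin.dist_S b (q a)"
      using H.fin.cayley.dist_tri mem that(2) by blast
    also have "H.fin.dist_S b (q a) = H.fin.dist_S (q a) b" using H.fin.cayley.dist_sym mem that(2) by blast
    finally have "H.fin.dist_S (q (r b)) (q a) \<le> K0 + n" using qr[OF that(2)] that(3) by linarith
    then have "K0 * H.fin.dist_S (q (r b)) (q a) \<le> K0 * (K0 + n)" by (rule mult_le_mono2)
    then show ?thesis using low0[OF r[OF that(2)] that(1)] by linarith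
  qed
  define R where "R = {(A, B) \<in> left_cosets G \<P> \<times> left_cosets H \<Q>.
    ereal_of_enat (hausdorff_dist (word_dist H T0) (q ` A) B) < ereal M}"
  have R: "fst ` R = left_cosets G \<P>" "snd ` R = left_cosets H \<Q>"
    using const unfolding qi_of_pairs_const_def Let_def R_def by blast+
  let ?m = "nat \<lceil>M\<rceil>"
  have R_close: "A \<in> left_cosets G \<P> \<and> B \<in> left_cosets H \<Q> \<and> set_close H.fin.dist_S ?m (q ` A) B"
    if "(A, B) \<in> R" for A B
  proof -
    have AB: "A \<in> left_cosets G \<P>" "B \<in> left_cosets H \<Q>"
      "ereal_of_enat (hausdorff_dist (word_dist H T0) (q ` A) B) < ereal M" using that unfolding R_def by auto
    have "q ` A \<subseteq> carrier H" "B \<subseteq> carrier H" using G.coset_closed H.coset_closed AB q by blast+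
    then show ?thesis
      using set_close_if_hausdorff_dist[OF H.fin.cayley.connected_graph_axioms] AB
      unfolding word_dist_def by blast
  qed
  have "coarsely_maps_into H.fin.dist_S q (left_cosets G \<P>) (left_cosets H \<Q>)"
    unfolding coarsely_maps_into_def
  proof (intro exI ballI)
    fix A assume "A \<in> left_cosets G \<P>"
    then obtain B where "(A, B) \<in> R" unfolding R(1)[symmetric] by auto
    then show "\<exists>B\<in>left_cosets H \<Q>. set_close H.fin.dist_S ?m (q ` A) B" using R_close by blast
  qed
  moreover have "coarsely_maps_into G.fin.dist_S r (left_cosets H \<Q>) (left_cosets G \<P>)"
    unfolding coarsely_maps_into_def
  proof (intro exI ballI)
    fix B assume "B \<in> left_cosets H \<Q>"
    then obtain A where "(A, B) \<in> R" unfolding R(2)[symmetric] by auto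
    then have A: "A \<in> left_cosets G \<P>" and B: "B \<in> left_cosets H \<Q>"
      and close: "set_close H.fin.dist_S ?m (q ` A) B" using R_close by blast+
    have near: "G.fin.dist_S (r b) a \<le> K0 * (K0 + ?m) + K0"
      if "a \<in> A" "b \<in> B" "H.fin.dist_S (q a) b \<le> ?m" for a b
      using back_near[OF _ _ that(3)] G.coset_closed[OF A] H.coset_closed[OF B] that by blast
    have "set_close G.fin.dist_S (K0 * (K0 + ?m) + K0) (r ` B) A"
      unfolding set_close_def
    proof (intro conjI ballI)
      fix x assume "x \<in> r ` B"
      then obtain b where b: "b \<in> B" "x = r b" by blast
      then obtain a where "a \<in> A" "H.fin.dist_S (q a) b \<le> ?m" using close unfolding set_close_def by blast
      then show "\<exists>a\<in>A. G.fin.dist_S x a \<le> K0 * (K0 + ?m) + K0" using near b by blast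
    next
      fix a assume a: "a \<in> A"
      then obtain b where "b \<in> B" "H.fin.dist_S (q a) b \<le> ?m" using close unfolding set_close_def by blast
      then show "\<exists>x\<in>r ` B. G.fin.dist_S x a \<le> K0 * (K0 + ?m) + K0" using near a by blast
    qed
    then show "\<exists>A\<in>left_cosets G \<P>. set_close G.fin.dist_S (K0 * (K0 + ?m) + K0) (r ` B) A" using A by blast
  qed
  moreover have "coarsely_lipschitz (carrier H) H.fin.dist_S G.fin.dist_S r"
    by (rule coarsely_lipschitz_section[OF H.fin.cayley.geodesic_space_axioms q r low0 qr])
  moreover have "coarsely_lipschitz (carrier H) H.dist_S G.dist_S r"
    by (rule coarsely_lipschitz_section[OF H.cayley.geodesic_space_axioms q r low qr'])
  moreover have "coarsely_lipschitz (carrier G) G.fin.dist_S H.fin.dist_S q"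
    using up0 unfolding coarsely_lipschitz_def by blast
  moreover have "coarsely_lipschitz (carrier G) G.dist_S H.dist_S q"
    using up unfolding coarsely_lipschitz_def by blast
  moreover have "coarse_inverse (carrier H) H.fin.dist_S q r"
    using qr unfolding coarse_inverse_def by blast
  moreover have "coarse_inverse (carrier G) G.fin.dist_S r q"
    unfolding coarse_inverse_def
  proof (intro exI ballI)
    fix x assume x: "x \<in> carrier G"
    then have "H.fin.dist_S (q x) (q x) \<le> 0" using q H.fin.cayley.dist_self by simp
    then show "G.fin.dist_S (r (q x)) x \<le> K0 * (K0 + 0) + K0" using back_near x q by blast
  qed
  ultimately have "pair_equivalence G S0 S \<P> H T0 T \<Q> q r"
    using q r by unfold_locales
  then show ?thesis by blast
qed

section \<open>Quasi-isometry invariance of hyperbolically embedded collections\<close>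

theorem theoremA:
  fixes G :: "('a, 'm) monoid_scheme" and H :: "('b, 'n) monoid_scheme"
    and q :: "'a \<Rightarrow> 'b"
    and S\<^sub>0 S :: "'a set" and T\<^sub>0 T :: "'b set"
    and \<P> :: "'a set set" and \<Q> :: "'b set set"
  assumes "group G" and "group H"
    and "finite S\<^sub>0" and "generating_set G S\<^sub>0"
    and "finite T\<^sub>0" and "generating_set H T\<^sub>0"
    and "quasi_isometry (carrier G) (word_dist G S\<^sub>0) (carrier H) (word_dist H T\<^sub>0) q"
    and "finite \<P>" and "\<And>P. P \<in> \<P> \<Longrightarrow> subgroup P G"
    and "finite \<Q>" and "\<And>Q. Q \<in> \<Q> \<Longrightarrow> subgroup Q H"
    and "generating_set G S" and "generating_set H T"
    and "qi_of_pairs G S\<^sub>0 \<P> H T\<^sub>0 \<Q> q"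
    and "quasi_isometry (carrier G) (word_dist G S) (carrier H) (word_dist H T) q"
  shows "(reduced G \<P> \<and> reduced H \<Q> \<longrightarrow>
            (hyperbolically_embedded G \<P> S \<longleftrightarrow> hyperbolically_embedded H \<Q> T)) \<and>
         ((\<forall>Q\<in>\<Q>. infinite Q) \<and> hyperbolically_embedded H \<Q> T \<longrightarrow>
            (\<forall>\<P>'. is_refinement G \<P> \<P>' \<longrightarrow> hyperbolically_embedded G \<P>' S))"
proof -
  note sub_G = assms(9) and sub_H = assms(11)
  interpret group G by fact
  interpret H: group H by fact
  have "group_pair G S\<^sub>0 S \<P>"
    using assms(3,4,12) sub_G subgroup.subset subgroup.one_closed by unfold_locales blast+
  moreover have "group_pair H T\<^sub>0 T \<Q>"
    using assms(5,6,13) sub_H subgroup.subset subgroup.one_closed by unfold_locales blast+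
  ultimately obtain r where equiv: "pair_equivalence G S\<^sub>0 S \<P> H T\<^sub>0 T \<Q> q r"
    using pair_equivalence_if_qi_of_pairs assms(14,15) by blast
  interpret pair_equivalence G S\<^sub>0 S \<P> H T\<^sub>0 T \<Q> q r by (rule equiv)
  have "hyperbolically_embedded G \<P> S \<longleftrightarrow> hyperbolically_embedded H \<Q> T"
    if "reduced G \<P>" "reduced H \<Q>"
  proof
    assume "hyperbolically_embedded H \<Q> T"
    then show "hyperbolically_embedded G \<P> S"
      using hyperbolically_embedded_transfer G.separated_cosets_if_reduced sub_G that(1) by blast
  next
    assume "hyperbolically_embedded G \<P> S"
    then show "hyperbolically_embedded H \<Q> T"
      using pair_equivalence.hyperbolically_embedded_transfer[OF swap]
        H.separated_cosets_if_reduced sub_H that(2) by blast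
  qed
  moreover have "hyperbolically_embedded G \<P>' S"
    if inf: "\<forall>Q\<in>\<Q>. infinite Q" and hyp: "hyperbolically_embedded H \<Q> T"
      and ref: "is_refinement G \<P> \<P>'" for \<P>'
  proof -
    have "H.separated_cosets"
      using H.separated_cosets_if_fine inf hyp unfolding H.hyperbolically_embedded_iff by blast
    note refined = refinement_equivalence[OF this assms(8) sub_G ref]
    show ?thesis
      by (rule pair_equivalence.hyperbolically_embedded_transfer[OF refined hyp])
  qed
  ultimately show ?thesis by blast
qed

end
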